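(* Let $q_1,q_2<1$ with $q_1<q^*$ or $q_2\le q^*$. Assume that $V_i\in C^1(0,\infty)$ and $$\lim_{y\to0}\frac{V_i'(y)}{y^{q_i-1}}=-1,\qquad i=1,2.$$ Then for every $x>0$, $$\lim_{t\to\infty}A(x,t)=\frac{\theta}{\sigma}\,(1-\min\{q_1,q_2\})\,x .$$ If, moreover, for some $\hat q<0$, $$\lim_{y\to\infty}\frac{V_2'(y)}{y^{\hat q-1}}=-1,$$ then for every $x>0$ $$\lim_{t\to\infty}R(t)^{\frac{\hat q-1}{q_2-1}}\,C(x,t)=x^{\frac{\hat q-1}{\min\{q_1,q_2\}-1}},$$ where, with $\lambda_i=\lambda(q_i)$, $$R(t)=\begin{cases} e^{\lambda_1 t}+\dfrac{e^{\lambda_2 t}-1}{\lambda_2}, & q_1=q_2,\\[2mm] e^{\frac{q_2-1}{q_1-1}\lambda_1 t}, & q_1<q_2,\\[2mm] \dfrac{e^{\lambda_2 t}-1}{\lambda_2}, & q_1>q_2,\end{cases}$$ and $(e^{\lambda_2 t}-1)/\lambda_2$ is read as $t$ if $\lambda_2=0$.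
   Context: Market and problem. Let $r>0$ (riskless rate), $\delta>0$ (discount rate), $\mu>0$, $\sigma>0$ be constants, $\theta=\sigma^{-1}(\mu-r)\neq0$ (Sharpe ratio), and $W$ a standard Brownian motion. Wealth satisfies $dX_s=rX_s\,ds+X_s\pi_s\sigma(\theta\,ds+dW_s)-c_s\,ds$, where $\pi_s$ is the proportion of wealth in the risky asset and $c_s\ge0$ is the consumption rate. The agent maximizes $E\big[\int_0^T e^{-\delta s}U_2(c_s)\,ds+e^{-\delta T}U_1(X_T)\big]$ over $(\pi,c)$. The variable $t$ denotes the time horizon (time remaining to the terminal date), so the distant-horizon limit is $t\to\infty$. Standing assumptions on utilities, $i=1,2$: $U_i$ is continuously differentiable, strictly increasing and strictly concave on $(0,\infty)$, $U_i(0)=0$, $U_i'(0)=\infty$, $U_i'(\infty)=0$, and $U_i(x)\le C_0(1+x^p)$ for $x\ge0$ and some constants $C_0>0$, $0<p<1$. The dual functions are $V_i(y)=\sup_{x\ge0}\{U_i(x)-xy\}$, $y>0$. Constants: $\alpha=\frac12+\frac{r-\delta}{\theta^2}$, $a=\frac{\theta}{\sqrt2}$, $\beta=-a^2\alpha^2-\delta$, and for $q<1$ $$\lambda(q)=\beta+(\alpha-q)^2a^2=\tfrac12\theta^2q(q-1)-rq+\delta(q-1).$$ The threshold $q^*=\alpha-\sqrt{\alpha^2+2\delta/\theta^2}<0$ is the unique root of $\lambda$ in $(-\infty,1)$. Optimal strategies. For $y>0$, $t>0$ (with $\pi$ in the next formula the number $3.14\ldots$) let $$I_i(y,t)=\frac{e^{\beta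 t}}{2\sqrt{\pi}}\int_{-\infty}^\infty e^{-\frac{\eta^2}{4}-(\alpha-1)a\sqrt t\,\eta}\,\big|V_i'(ye^{a\sqrt t\,\eta})\big|\,d\eta,\qquad v_y(y,t)=-I_1(y,t)-\int_0^tI_2(y,\tau)\,d\tau .$$ For $x>0$, $t>0$, let $y=y(x,t)>0$ be the unique solution of $x=-v_y(y,t)$. The optimal amount of money in the risky asset and the optimal consumption rate at wealth $x$ with horizon $t$ are $$A(x,t)=\frac{\theta}{\sigma}\,y\,v_{yy}(y,t),\qquad C(x,t)=-V_2'(y),\qquad y=y(x,t),$$ where $v_{yy}=\partial_y v_y$. *)

theory Defs
  imports "HOL-Analysis.Analysis"
begin

definition strictly_concave_on :: "real set \<Rightarrow> (real \<Rightarrow> real) \<Rightarrow> bool" where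
  "strictly_concave_on S f \<longleftrightarrow> convex S \<and>
     (\<forall>x\<in>S. \<forall>y\<in>S. \<forall>u. x \<noteq> y \<and> 0 < u \<and> u < 1 \<longrightarrow>
        u * f x + (1 - u) * f y < f (u * x + (1 - u) * y))"

text \<open>Utility functions live on \<open>[0, \<infinity>)\<close>; their values at negative arguments play no role.\<close>

definition is_utility :: "(real \<Rightarrow> real) \<Rightarrow> bool" where
  "is_utility U \<longleftrightarrow>
     U C1_differentiable_on {0<..} \<and>
     strict_mono_on {0<..} U \<and>
     strictly_concave_on {0<..} U \<and>
     U 0 = 0 \<and>
     filterlim (deriv U) at_top (at_right 0) \<and>
     (deriv U \<longlongrightarrow> 0) at_top \<and>
     (\<exists>C\<^sub>0 p. 0 < C\<^sub>0 \<and> 0 < p \<and> p < 1 \<and> (\<forall>x\<ge>0. U x \<le> C\<^sub>0 * (1 + x powr p)))"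

text \<open>The growth bound in \<open>is_utility\<close> makes the set below bounded above for \<open>y > 0\<close>,
  so the real-valued supremum is the intended one.\<close>

definition dual_fun :: "(real \<Rightarrow> real) \<Rightarrow> real \<Rightarrow> real" where
  "dual_fun U y = (SUP x\<in>{0..}. U x - x * y)"

text \<open>Parameters: \<open>r\<close> riskless rate, \<open>\<delta>\<close> discount rate, \<open>\<sigma>\<close> volatility, \<open>\<theta>\<close> Sharpe ratio.\<close>

definition alpha_c :: "real \<Rightarrow> real \<Rightarrow> real \<Rightarrow> real" where
  "alpha_c r \<delta> \<theta> = 1 / 2 + (r - \<delta>) / \<theta>\<^sup>2"

definition a_c :: "real \<Rightarrow> real" where
  "a_c \<theta> = \<theta> / sqrt 2"

definition beta_c :: "real \<Rightarrow> real \<Rightarrow> real \<Rightarrow> real" where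
  "beta_c r \<delta> \<theta> = - (a_c \<theta>)\<^sup>2 * (alpha_c r \<delta> \<theta>)\<^sup>2 - \<delta>"

definition lambda_c :: "real \<Rightarrow> real \<Rightarrow> real \<Rightarrow> real \<Rightarrow> real" where
  "lambda_c r \<delta> \<theta> q = beta_c r \<delta> \<theta> + (alpha_c r \<delta> \<theta> - q)\<^sup>2 * (a_c \<theta>)\<^sup>2"

definition q_star :: "real \<Rightarrow> real \<Rightarrow> real \<Rightarrow> real" where
  "q_star r \<delta> \<theta> = alpha_c r \<delta> \<theta> - sqrt ((alpha_c r \<delta> \<theta>)\<^sup>2 + 2 * \<delta> / \<theta>\<^sup>2)"

definition I_fun :: "real \<Rightarrow> real \<Rightarrow> real \<Rightarrow> (real \<Rightarrow> real) \<Rightarrow> real \<Rightarrow> real \<Rightarrow> real" where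
  "I_fun r \<delta> \<theta> U y t =
     exp (beta_c r \<delta> \<theta> * t) / (2 * sqrt pi) *
     (LBINT \<eta>. exp (- \<eta>\<^sup>2 / 4 - (alpha_c r \<delta> \<theta> - 1) * a_c \<theta> * sqrt t * \<eta>) *
        \<bar>deriv (dual_fun U) (y * exp (a_c \<theta> * sqrt t * \<eta>))\<bar>)"

definition v_y :: "real \<Rightarrow> real \<Rightarrow> real \<Rightarrow> (real \<Rightarrow> real) \<Rightarrow> (real \<Rightarrow> real) \<Rightarrow> real \<Rightarrow> real \<Rightarrow> real" where
  "v_y r \<delta> \<theta> U\<^sub>1 U\<^sub>2 y t = - I_fun r \<delta> \<theta> U\<^sub>1 y t - (LBINT \<tau>:{0..t}. I_fun r \<delta> \<theta> U\<^sub>2 y \<tau>)"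

definition y_sol :: "real \<Rightarrow> real \<Rightarrow> real \<Rightarrow> (real \<Rightarrow> real) \<Rightarrow> (real \<Rightarrow> real) \<Rightarrow> real \<Rightarrow> real \<Rightarrow> real" where
  "y_sol r \<delta> \<theta> U\<^sub>1 U\<^sub>2 x t = (THE y. 0 < y \<and> x = - v_y r \<delta> \<theta> U\<^sub>1 U\<^sub>2 y t)"

text \<open>Optimal amount of money in the risky asset and optimal consumption rate, at wealth \<open>x\<close>
  with time \<open>t\<close> remaining.\<close>

definition risky_amount ::
  "real \<Rightarrow> real \<Rightarrow> real \<Rightarrow> real \<Rightarrow> (real \<Rightarrow> real) \<Rightarrow> (real \<Rightarrow> real) \<Rightarrow> real \<Rightarrow> real \<Rightarrow> real" where
  "risky_amount r \<delta> \<sigma> \<theta> U\<^sub>1 U\<^sub>2 x t =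
     (let y = y_sol r \<delta> \<theta> U\<^sub>1 U\<^sub>2 x t
      in \<theta> / \<sigma> * y * deriv (\<lambda>z. v_y r \<delta> \<theta> U\<^sub>1 U\<^sub>2 z t) y)"

definition consumption ::
  "real \<Rightarrow> real \<Rightarrow> real \<Rightarrow> (real \<Rightarrow> real) \<Rightarrow> (real \<Rightarrow> real) \<Rightarrow> real \<Rightarrow> real \<Rightarrow> real" where
  "consumption r \<delta> \<theta> U\<^sub>1 U\<^sub>2 x t = - deriv (dual_fun U\<^sub>2) (y_sol r \<delta> \<theta> U\<^sub>1 U\<^sub>2 x t)"

definition exp_avg :: "real \<Rightarrow> real \<Rightarrow> real" where
  "exp_avg l t = (if l = 0 then t else (exp (l * t) - 1) / l)"

definition R_fun :: "real \<Rightarrow> real \<Rightarrow> real \<Rightarrow> real \<Rightarrow> real \<Rightarrow> real \<Rightarrow> real" where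
  "R_fun r \<delta> \<theta> q\<^sub>1 q\<^sub>2 t =
     (if q\<^sub>1 = q\<^sub>2 then exp (lambda_c r \<delta> \<theta> q\<^sub>1 * t) + exp_avg (lambda_c r \<delta> \<theta> q\<^sub>2) t
      else if q\<^sub>1 < q\<^sub>2 then exp ((q\<^sub>2 - 1) / (q\<^sub>1 - 1) * lambda_c r \<delta> \<theta> q\<^sub>1 * t)
      else exp_avg (lambda_c r \<delta> \<theta> q\<^sub>2) t)"

end

theory Submission
  imports Defs "HOL-Probability.Distributions" "HOL-Real_Asymp.Real_Asymp"
begin

text \<open>In the coordinate \<open>u = ln y\<close> the integral \<open>I_i\<close> is a Gaussian average of
  \<open>\<phi>\<^sub>i s = \<bar>V\<^sub>i' (exp s)\<bar>\<close>, and it maps \<open>exp ((m - 1) * s)\<close> to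
  \<open>exp ((m - 1) * u + \<lambda>(m) * t)\<close>. As \<open>V\<^sub>i\<close> is convex, nonnegative and decreasing,
  \<open>\<bar>V\<^sub>i' y\<bar>\<close> is \<open>O(1/y)\<close> at infinity, so that
  \<open>\<bar>\<phi>\<^sub>i s - exp ((q\<^sub>i - 1) * s)\<bar> \<le> \<epsilon> * exp ((q\<^sub>i - 1) * s) + C * exp ((m - 1) * s)\<close> on the whole line
  for every \<open>m \<ge> 0\<close> with \<open>q\<^sub>i < m < 1\<close>. Averaging keeps this form, also after differentiation in \<open>u\<close>.
  The quotient \<open>\<lambda>(q) / (1 - q)\<close> is strictly decreasing on \<open>q < 1\<close>; therefore along every path on which
  the dominant term, of exponent \<open>q = min q\<^sub>1 q\<^sub>2\<close>, stays of order one, all terms of larger exponent vanish.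
  Hence \<open>- v_y\<close> and \<open>y * v_yy\<close> are asymptotic to the dominant term times \<open>1\<close> and
  \<open>1 - q\<close>, and monotonicity of \<open>v_y\<close> pins down \<open>y(x, t)\<close>.\<close>

text \<open>The root y(x, t) tends to infinity, and yet the behaviour of V' near 0 decides the
  limit. Heuristically, a dominant term of order one means that u is about t * \<lambda>(q) / (1 -
  q). Against exp ((q - 1) * s) the Gaussian weight is centred at s = u + (q - \<alpha>) *
  \<theta>^2 * t, which is about - (\<theta>^2 * (1 - q) / 2 + r / (1 - q)) * t and tends to minus
  infinity. On such a path a term of exponent m has the rate (1 - m) * (\<lambda>(m) / (1 - m) -
  \<lambda>(q) / (1 - q)), negative for q < m < 1. The obstacle is uniformity. The path u(t) is not
  known in advance, and the horizon integral at u(t) runs through all \<tau> in (0, t], so pointwise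
  limits in t for fixed u are of no use. Every error estimate therefore holds for all u and all t >
  0 with the same constants. The threshold makes the coefficient of the dominant term unbounded in
  t, whence u(t) tends to infinity. At \<lambda> = 0 the integrated term still grows like t, while
  exp (\<lambda> * t) does not grow; hence the strict inequality for the first exponent and the weak
  one for the second.\<close>

section \<open>Gaussian averages\<close>

lemma has_real_derivative_integral:
  fixes f f' :: "real \<Rightarrow> 'a \<Rightarrow> real"
  assumes "0 < e"
    and int: "\<And>y. \<bar>y - x\<bar> < e \<Longrightarrow> integrable M (f y)"
    and der: "AE \<omega> in M. \<forall>y. \<bar>y - x\<bar> < e \<longrightarrow> ((\<lambda>y. f y \<omega>) has_real_derivative f' y \<omega>) (at y)"
    and bnd: "AE \<omega> in M. \<forall>y. \<bar>y - x\<bar> < e \<longrightarrow> \<bar>f' y \<omega>\<bar> \<le> w \<omega>"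
    and w: "integrable M w"
    and meas: "f' x \<in> borel_measurable M"
  shows "((\<lambda>y. \<integral>\<omega>. f y \<omega> \<partial>M) has_real_derivative (\<integral>\<omega>. f' x \<omega> \<partial>M)) (at x)"
  unfolding has_field_derivative_iff tendsto_at_iff_sequentially
proof (intro allI impI)
  fix X :: "nat \<Rightarrow> real"
  assume X: "\<forall>i. X i \<in> UNIV - {x}" "X \<longlonglongrightarrow> x"
  from X(2) \<open>0 < e\<close> obtain N where N: "\<And>n. n \<ge> N \<Longrightarrow> \<bar>X n - x\<bar> < e"
    unfolding LIMSEQ_iff by auto
  define Y where "Y n = X (n + N)" for n
  have Yx: "Y n \<noteq> x" "\<bar>Y n - x\<bar> < e" for n
    using X(1) N[of "n + N"] by (auto simp: Y_def)
  have Ylim: "Y \<longlonglongrightarrow> x"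
    using X(2) unfolding Y_def by (rule LIMSEQ_ignore_initial_segment)
  define s where "s n \<omega> = (f (Y n) \<omega> - f x \<omega>) / (Y n - x)" for n \<omega>
  have intx: "integrable M (f x)" "\<And>n. integrable M (f (Y n))"
    using int \<open>0 < e\<close> Yx by auto
  have "(\<lambda>n. \<integral>\<omega>. s n \<omega> \<partial>M) \<longlonglongrightarrow> (\<integral>\<omega>. f' x \<omega> \<partial>M)"
  proof (rule integral_dominated_convergence[where w = w])
    show "f' x \<in> borel_measurable M" by fact
    show "s n \<in> borel_measurable M" for n
      unfolding s_def using intx by (auto intro!: borel_measurable_integrable)
    show "integrable M w" by fact
    show "AE \<omega> in M. (\<lambda>n. s n \<omega>) \<longlonglongrightarrow> f' x \<omega>"
      using der
    proof eventually_elim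
      case (elim \<omega>)
      then have "((\<lambda>y. (f y \<omega> - f x \<omega>) / (y - x)) \<longlongrightarrow> f' x \<omega>) (at x)"
        using \<open>0 < e\<close> by (simp add: has_field_derivative_iff)
      then show ?case
        using Ylim Yx(1) unfolding tendsto_at_iff_sequentially s_def comp_def by auto
    qed
    show "AE \<omega> in M. norm (s n \<omega>) \<le> w \<omega>" for n
      using der bnd
    proof eventually_elim
      case (elim \<omega>)
      \<comment> \<open>By the mean value theorem every difference quotient is a value of
        \<open>f'\<close> at a nearby point, so \<open>w\<close> dominates the quotients as
        well.\<close>
      have "\<exists>z. \<bar>z - x\<bar> < e \<and> f (Y n) \<omega> - f x \<omega> = (Y n - x) * f' z \<omega>"
      proof (cases "x < Y n")
        case True
        then have "\<exists>z>x. z < Y n \<and> f (Y n) \<omega> - f x \<omega> = (Y n - x) * f' z \<omega>"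
          using elim(1) Yx(2)[of n] by (intro MVT2) auto
        then obtain z where "z > x" "z < Y n" "f (Y n) \<omega> - f x \<omega> = (Y n - x) * f' z \<omega>" by auto
        then show ?thesis using Yx(2)[of n] by (intro exI[of _ z]) auto
      next
        case False
        then have "Y n < x" using Yx(1)[of n] by auto
        then have "\<exists>z>Y n. z < x \<and> f x \<omega> - f (Y n) \<omega> = (x - Y n) * f' z \<omega>"
          using elim(1) Yx(2)[of n] by (intro MVT2) auto
        then obtain z where "z > Y n" "z < x" "f x \<omega> - f (Y n) \<omega> = (x - Y n) * f' z \<omega>" by auto
        then show ?thesis using Yx(2)[of n] by (intro exI[of _ z]) (auto simp: algebra_simps)
      qed
      then obtain z where "\<bar>z - x\<bar> < e" "s n \<omega> = f' z \<omega>"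
        using Yx(1)[of n] unfolding s_def by auto
      then show ?case using elim(2) by auto
    qed
  qed
  moreover have "(\<integral>\<omega>. s n \<omega> \<partial>M) = ((\<integral>\<omega>. f (Y n) \<omega> \<partial>M) - (\<integral>\<omega>. f x \<omega> \<partial>M)) / (Y n - x)" for n
    unfolding s_def using intx by simp
  ultimately have "(\<lambda>n. ((\<lambda>y. ((\<integral>\<omega>. f y \<omega> \<partial>M) - (\<integral>\<omega>. f x \<omega> \<partial>M)) / (y - x)) \<circ> X) (n + N))
      \<longlonglongrightarrow> (\<integral>\<omega>. f' x \<omega> \<partial>M)"
    by (simp add: Y_def comp_def)
  then show "((\<lambda>y. ((\<integral>\<omega>. f y \<omega> \<partial>M) - (\<integral>\<omega>. f x \<omega> \<partial>M)) / (y - x)) \<circ> X)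
      \<longlonglongrightarrow> (\<integral>\<omega>. f' x \<omega> \<partial>M)"
    by (rule LIMSEQ_offset)
qed

lemma abs_le_exp_abs: "\<bar>x::real\<bar> \<le> exp \<bar>x\<bar>"
  using exp_ge_add_one_self[of "\<bar>x\<bar>"] by linarith

lemma has_real_derivative_mgf:
  fixes f :: "real \<Rightarrow> real"
  assumes f: "\<And>k. integrable lborel (\<lambda>x. exp (k * x) * f x)"
  shows "((\<lambda>w. LBINT x. exp (w * x) * f x) has_real_derivative (LBINT x. x * exp (w * x) * f x)) (at w)"
proof (rule has_real_derivative_integral[where e = 1
      and w = "\<lambda>x. exp ((\<bar>w\<bar> + 2) * x) * \<bar>f x\<bar> + exp (- (\<bar>w\<bar> + 2) * x) * \<bar>f x\<bar>"])
  have [measurable]: "f \<in> borel_measurable borel"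
    using borel_measurable_integrable[OF f[of 0]] by simp
  have abs_int: "integrable lborel (\<lambda>x. exp (k * x) * \<bar>f x\<bar>)" for k
    using integrable_abs[OF f[of k]] by (simp add: abs_mult)
  show "integrable lborel (\<lambda>x. exp ((\<bar>w\<bar> + 2) * x) * \<bar>f x\<bar> + exp (- (\<bar>w\<bar> + 2) * x) * \<bar>f x\<bar>)"
    by (intro Bochner_Integration.integrable_add abs_int)
  show "(\<lambda>x. x * exp (w * x) * f x) \<in> borel_measurable lborel" by measurable
  show "AE x in lborel. \<forall>y. \<bar>y - w\<bar> < 1 \<longrightarrow>
      ((\<lambda>y. exp (y * x) * f x) has_real_derivative (x * exp (y * x) * f x)) (at y)"
    by (auto intro!: AE_I2 derivative_eq_intros)
  \<comment> \<open>In \<open>\<bar>w\<bar> + 2\<close> one unit covers the neighbourhood of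
    \<open>w\<close>, the other absorbs the factor \<open>\<bar>x\<bar>\<close> through
    \<open>\<bar>x\<bar> \<le> exp \<bar>x\<bar>\<close>.\<close>
  have key: "\<bar>x\<bar> * exp (y * x) \<le> exp ((\<bar>w\<bar> + 2) * x) + exp (- (\<bar>w\<bar> + 2) * x)"
    if "\<bar>y - w\<bar> < 1" for x y :: real
  proof -
    have "y * x \<le> \<bar>y\<bar> * \<bar>x\<bar>"
      by (metis abs_ge_self abs_mult)
    also have "\<dots> \<le> (\<bar>w\<bar> + 1) * \<bar>x\<bar>"
      using that by (intro mult_right_mono) auto
    finally have "\<bar>x\<bar> * exp (y * x) \<le> exp \<bar>x\<bar> * exp ((\<bar>w\<bar> + 1) * \<bar>x\<bar>)"
      by (intro mult_mono abs_le_exp_abs) auto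
    also have "\<dots> = exp ((\<bar>w\<bar> + 2) * \<bar>x\<bar>)"
      by (simp add: exp_add[symmetric] algebra_simps)
    also have "\<dots> \<le> exp ((\<bar>w\<bar> + 2) * x) + exp (- (\<bar>w\<bar> + 2) * x)"
      using exp_gt_zero[of "(\<bar>w\<bar> + 2) * x"] exp_gt_zero[of "- (\<bar>w\<bar> + 2) * x"]
      by (cases "x \<ge> 0") (simp_all add: algebra_simps del: exp_gt_zero)
    finally show ?thesis .
  qed
  show "AE x in lborel. \<forall>y. \<bar>y - w\<bar> < 1 \<longrightarrow> \<bar>x * exp (y * x) * f x\<bar>
      \<le> exp ((\<bar>w\<bar> + 2) * x) * \<bar>f x\<bar> + exp (- (\<bar>w\<bar> + 2) * x) * \<bar>f x\<bar>"
  proof (intro AE_I2 allI impI)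
    fix x y assume "\<bar>y - w\<bar> < 1"
    from mult_right_mono[OF key[OF this, of x], of "\<bar>f x\<bar>"]
    show "\<bar>x * exp (y * x) * f x\<bar>
      \<le> exp ((\<bar>w\<bar> + 2) * x) * \<bar>f x\<bar> + exp (- (\<bar>w\<bar> + 2) * x) * \<bar>f x\<bar>"
      by (simp add: abs_mult distrib_right)
  qed
qed (auto simp: f)

text \<open>Completing the square turns the integrand into a multiple of the normal density with
  mean 2 * k and variance 2.\<close>

lemma has_bochner_integral_gauss_exp:
  "has_bochner_integral lborel (\<lambda>\<eta>. exp (- \<eta>\<^sup>2 / 4 + k * \<eta>)) (2 * sqrt pi * exp (k\<^sup>2))"
proof -
  have "has_bochner_integral lborel (normal_density (2 * k) (sqrt 2)) 1"
    by (simp add: has_bochner_integral_iff)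
  from has_bochner_integral_mult_right[OF this, of "2 * sqrt pi * exp (k\<^sup>2)"]
  have "has_bochner_integral lborel
      (\<lambda>x. 2 * sqrt pi * exp (k\<^sup>2) * normal_density (2 * k) (sqrt 2) x) (2 * sqrt pi * exp (k\<^sup>2))"
    by simp
  moreover have "2 * sqrt pi * exp (k\<^sup>2) * normal_density (2 * k) (sqrt 2) x = exp (- x\<^sup>2 / 4 + k * x)" for x
  proof -
    have "sqrt (2 * pi * (sqrt 2)\<^sup>2) = 2 * sqrt pi"
      by (simp add: real_sqrt_mult)
    moreover have "exp (k\<^sup>2) * exp (- (x - 2 * k)\<^sup>2 / (2 * (sqrt 2)\<^sup>2)) = exp (- x\<^sup>2 / 4 + k * x)"
      by (simp add: exp_add[symmetric] power2_eq_square field_simps)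
    ultimately show ?thesis
      by (simp add: normal_density_def)
  qed
  ultimately show ?thesis by simp
qed

lemma integrable_gauss_exp_abs: "integrable lborel (\<lambda>\<eta>. exp (- \<eta>\<^sup>2 / 4 + k * \<bar>\<eta>\<bar>) :: real)"
proof (rule Bochner_Integration.integrable_bound)
  show "integrable lborel (\<lambda>\<eta>::real. exp (- \<eta>\<^sup>2 / 4 + k * \<eta>) + exp (- \<eta>\<^sup>2 / 4 + (- k) * \<eta>))"
    using has_bochner_integral_gauss_exp[of k] has_bochner_integral_gauss_exp[of "- k"]
    by (auto simp only: has_bochner_integral_iff intro!: Bochner_Integration.integrable_add)
  show "AE \<eta> in lborel. norm (exp (- \<eta>\<^sup>2 / 4 + k * \<bar>\<eta>\<bar>))
      \<le> norm (exp (- \<eta>\<^sup>2 / 4 + k * \<eta>) + exp (- \<eta>\<^sup>2 / 4 + - k * \<eta>))"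
  proof (rule AE_I2)
    fix \<eta> :: real
    have "0 < exp (- \<eta>\<^sup>2 / 4 + k * \<eta>)" "0 < exp (- \<eta>\<^sup>2 / 4 + - k * \<eta>)" by simp_all
    then show "norm (exp (- \<eta>\<^sup>2 / 4 + k * \<bar>\<eta>\<bar>))
        \<le> norm (exp (- \<eta>\<^sup>2 / 4 + k * \<eta>) + exp (- \<eta>\<^sup>2 / 4 + - k * \<eta>))"
      by (cases "0 \<le> \<eta>") (simp_all del: exp_gt_zero)
  qed
qed measurable

text \<open>For y = exp s this is at most power growth, both as y tends to 0 and as y tends to
  infinity. Continuity supplies measurability.\<close>

definition exp_growth :: "(real \<Rightarrow> real) \<Rightarrow> bool" where
  "exp_growth \<phi> \<longleftrightarrow> continuous_on UNIV \<phi> \<and> (\<exists>C k. \<forall>s. \<bar>\<phi> s\<bar> \<le> C * exp (k * \<bar>s\<bar>))"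

text \<open>The affine factor lets one definition cover the average, with (c, d) = (1, 0), and its
  derivative in u, with (c, d) = (A, 1 / (2 * b)).\<close>

definition gauss_avg :: "real \<Rightarrow> real \<Rightarrow> real \<Rightarrow> real \<Rightarrow> (real \<Rightarrow> real) \<Rightarrow> real \<Rightarrow> real" where
  "gauss_avg c d A b \<phi> u =
     (LBINT \<eta>. (c + d * \<eta>) * exp (- \<eta>\<^sup>2 / 4 - A * b * \<eta>) * \<phi> (u + b * \<eta>)) / (2 * sqrt pi)"

lemma exp_growth_measurable [measurable_dest]: "exp_growth \<phi> \<Longrightarrow> \<phi> \<in> borel_measurable borel"
  unfolding exp_growth_def by (auto intro: borel_measurable_continuous_onI)

lemma exp_growth_obtain:
  assumes "exp_growth \<phi>"
  obtains C k where "0 \<le> C" "0 \<le> k" "\<And>s. \<bar>\<phi> s\<bar> \<le> C * exp (k * \<bar>s\<bar>)"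
proof -
  obtain C k where *: "\<And>s. \<bar>\<phi> s\<bar> \<le> C * exp (k * \<bar>s\<bar>)"
    using assms unfolding exp_growth_def by auto
  have "0 \<le> C" using order_trans[OF abs_ge_zero *[of 0]] by simp
  moreover have "C * exp (k * \<bar>s\<bar>) \<le> C * exp (\<bar>k\<bar> * \<bar>s\<bar>)" for s
    using \<open>0 \<le> C\<close> by (intro mult_left_mono) (auto intro!: mult_right_mono)
  ultimately show thesis
    using order_trans[OF *] by (intro that[of C "\<bar>k\<bar>"]) auto
qed

lemma exp_growth_exp: "exp_growth (\<lambda>s. exp (p * s))"
  unfolding exp_growth_def
proof (intro conjI exI allI)
  show "continuous_on UNIV (\<lambda>s. exp (p * s))" by (intro continuous_intros)
  show "\<bar>exp (p * s)\<bar> \<le> 1 * exp (\<bar>p\<bar> * \<bar>s\<bar>)" for s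
    by (simp add: abs_mult[symmetric])
qed

lemma integrable_affine_gauss:
  assumes \<phi>: "exp_growth \<phi>"
  shows "integrable lborel (\<lambda>\<eta>. (c + d * \<eta>) * exp (- \<eta>\<^sup>2 / 4 - k * \<eta>) * \<phi> (u + b * \<eta>))"
proof -
  note [measurable] = exp_growth_measurable[OF \<phi>]
  obtain C l where C: "0 \<le> C" "0 \<le> l" "\<And>s. \<bar>\<phi> s\<bar> \<le> C * exp (l * \<bar>s\<bar>)"
    using exp_growth_obtain[OF \<phi>] by blast
  show ?thesis
  proof (rule Bochner_Integration.integrable_bound)
    show "integrable lborel (\<lambda>\<eta>. (\<bar>c\<bar> + \<bar>d\<bar>) * C * exp (l * \<bar>u\<bar>) * exp (- \<eta>\<^sup>2 / 4 + (1 + \<bar>k\<bar> + l * \<bar>b\<bar>) * \<bar>\<eta>\<bar>))"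
      by (intro integrable_mult_right integrable_gauss_exp_abs)
    show "AE \<eta> in lborel. norm ((c + d * \<eta>) * exp (- \<eta>\<^sup>2 / 4 - k * \<eta>) * \<phi> (u + b * \<eta>))
       \<le> norm ((\<bar>c\<bar> + \<bar>d\<bar>) * C * exp (l * \<bar>u\<bar>) * exp (- \<eta>\<^sup>2 / 4 + (1 + \<bar>k\<bar> + l * \<bar>b\<bar>) * \<bar>\<eta>\<bar>))"
    proof (rule AE_I2)
      fix \<eta> :: real
      have "\<bar>c + d * \<eta>\<bar> \<le> \<bar>c\<bar> * exp \<bar>\<eta>\<bar> + \<bar>d\<bar> * exp \<bar>\<eta>\<bar>"
        by (rule order_trans[OF abs_triangle_ineq])
          (auto simp: abs_mult abs_le_exp_abs mult_left_mono mult_le_cancel_left1 intro!: add_mono)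
      then have 1: "\<bar>c + d * \<eta>\<bar> \<le> (\<bar>c\<bar> + \<bar>d\<bar>) * exp \<bar>\<eta>\<bar>" by (simp add: algebra_simps)
      have "- k * \<eta> \<le> \<bar>k\<bar> * \<bar>\<eta>\<bar>" by (metis abs_ge_self abs_minus_cancel abs_mult)
      then have 2: "exp (- \<eta>\<^sup>2 / 4 - k * \<eta>) \<le> exp (- \<eta>\<^sup>2 / 4 + \<bar>k\<bar> * \<bar>\<eta>\<bar>)" by simp
      have "l * \<bar>u + b * \<eta>\<bar> \<le> l * (\<bar>u\<bar> + \<bar>b\<bar> * \<bar>\<eta>\<bar>)"
        using C(2) abs_triangle_ineq[of u "b * \<eta>"] by (intro mult_left_mono) (auto simp: abs_mult)
      then have 3: "\<bar>\<phi> (u + b * \<eta>)\<bar> \<le> C * exp (l * \<bar>u\<bar> + l * \<bar>b\<bar> * \<bar>\<eta>\<bar>)"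
        using C(1) by (intro order_trans[OF C(3)] mult_left_mono) (auto simp: algebra_simps)
      have "\<bar>(c + d * \<eta>) * exp (- \<eta>\<^sup>2 / 4 - k * \<eta>) * \<phi> (u + b * \<eta>)\<bar> \<le>
          ((\<bar>c\<bar> + \<bar>d\<bar>) * exp \<bar>\<eta>\<bar>) * exp (- \<eta>\<^sup>2 / 4 + \<bar>k\<bar> * \<bar>\<eta>\<bar>) * (C * exp (l * \<bar>u\<bar> + l * \<bar>b\<bar> * \<bar>\<eta>\<bar>))"
        unfolding abs_mult abs_exp_cancel using 1 2 3 C(1) by (intro mult_mono) auto
      also have "\<dots> = (\<bar>c\<bar> + \<bar>d\<bar>) * C * exp (l * \<bar>u\<bar>) *
          (exp \<bar>\<eta>\<bar> * exp (- \<eta>\<^sup>2 / 4 + \<bar>k\<bar> * \<bar>\<eta>\<bar>) * exp (l * \<bar>b\<bar> * \<bar>\<eta>\<bar>))"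
        by (simp only: exp_add[of "l * \<bar>u\<bar>"] mult_ac)
      also have "exp \<bar>\<eta>\<bar> * exp (- \<eta>\<^sup>2 / 4 + \<bar>k\<bar> * \<bar>\<eta>\<bar>) * exp (l * \<bar>b\<bar> * \<bar>\<eta>\<bar>)
          = exp (- \<eta>\<^sup>2 / 4 + (1 + \<bar>k\<bar> + l * \<bar>b\<bar>) * \<bar>\<eta>\<bar>)"
        by (simp add: exp_add[symmetric] algebra_simps)
      finally show "norm ((c + d * \<eta>) * exp (- \<eta>\<^sup>2 / 4 - k * \<eta>) * \<phi> (u + b * \<eta>))
        \<le> norm ((\<bar>c\<bar> + \<bar>d\<bar>) * C * exp (l * \<bar>u\<bar>) * exp (- \<eta>\<^sup>2 / 4 + (1 + \<bar>k\<bar> + l * \<bar>b\<bar>) * \<bar>\<eta>\<bar>))"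
        using C(1) by (simp add: abs_mult)
    qed
  qed measurable
qed

lemma gauss_avg_exp:
  "gauss_avg 1 0 A b (\<lambda>s. exp (p * s)) u = exp (p * u) * exp ((p - A)\<^sup>2 * b\<^sup>2)"
proof -
  have "exp (- \<eta>\<^sup>2 / 4 - A * b * \<eta>) * exp (p * (u + b * \<eta>))
      = exp (p * u) * exp (- \<eta>\<^sup>2 / 4 + (p - A) * b * \<eta>)" for \<eta> :: real
    by (simp add: exp_add[symmetric] algebra_simps)
  then have "gauss_avg 1 0 A b (\<lambda>s. exp (p * s)) u
      = exp (p * u) * (LBINT \<eta>. exp (- \<eta>\<^sup>2 / 4 + (p - A) * b * \<eta>)) / (2 * sqrt pi)"
    by (simp add: gauss_avg_def)
  then show ?thesis
    using has_bochner_integral_gauss_exp[of "(p - A) * b"]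
    by (simp add: has_bochner_integral_iff power_mult_distrib)
qed

text \<open>Translating the integration variable moves \<open>u\<close> out of \<open>\<phi>\<close>, and the integral becomes a
  Laplace transform in \<open>u\<close>; this is why no differentiability of \<open>\<phi>\<close> is needed.\<close>

lemma has_real_derivative_gauss_avg:
  assumes \<phi>: "exp_growth \<phi>" and b: "b \<noteq> 0"
  shows "(gauss_avg 1 0 A b \<phi> has_real_derivative gauss_avg A (1 / (2 * b)) A b \<phi> u) (at u)"
proof -
  define f where "f \<eta> = exp (- \<eta>\<^sup>2 / 4 - A * b * \<eta>) * \<phi> (b * \<eta>)" for \<eta>
  define G where "G v = exp (- v\<^sup>2 / 4 + A * b * v)" for v
  define M where "M w = (LBINT \<eta>. exp (w * \<eta>) * f \<eta>)" for w
  define M' where "M' w = (LBINT \<eta>. \<eta> * exp (w * \<eta>) * f \<eta>)" for w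
  have int: "integrable lborel (\<lambda>\<eta>. (c + d * \<eta>) * exp (k * \<eta>) * f \<eta>)" for c d k
  proof -
    have "(\<lambda>\<eta>. (c + d * \<eta>) * exp (k * \<eta>) * f \<eta>)
        = (\<lambda>\<eta>. (c + d * \<eta>) * exp (- \<eta>\<^sup>2 / 4 - (A * b - k) * \<eta>) * \<phi> (0 + b * \<eta>))"
      by (auto simp: f_def exp_add[symmetric] algebra_simps intro!: ext)
    then show ?thesis using integrable_affine_gauss[OF \<phi>, of c d "A * b - k" 0 b] by simp
  qed
  have M: "(M has_real_derivative M' w) (at w)" for w
    unfolding M_def M'_def using int[of 1 0] by (intro has_real_derivative_mgf) simp
  \<comment> \<open>With v = u / b, replacing \<eta> by \<eta> - v splits the weight into
    \<open>G v\<close>, the old weight and exp (v * \<eta> / 2). All dependence on u is then in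
    \<open>G\<close>, in the affine factor and in the argument v / 2 of the transforms
    \<open>M\<close> and \<open>M'\<close>.\<close>
  have shift: "gauss_avg c d A b \<phi> u
      = G (u / b) * ((c - d * (u / b)) * M (u / b / 2) + d * M' (u / b / 2)) / (2 * sqrt pi)" for c d u
  proof -
    define v where "v = u / b"
    have u: "u = b * v" using b by (simp add: v_def)
    have "(LBINT \<eta>. (c + d * \<eta>) * exp (- \<eta>\<^sup>2 / 4 - A * b * \<eta>) * \<phi> (u + b * \<eta>))
      = (LBINT \<eta>. (c + d * (- v + \<eta>)) * exp (- (- v + \<eta>)\<^sup>2 / 4 - A * b * (- v + \<eta>)) * \<phi> (u + b * (- v + \<eta>)))"
      by (subst lborel_integral_real_affine[where c = 1 and t = "- v"]) simp_all
    also have "\<dots> = (LBINT \<eta>. G v * ((c - d * v) * (exp (v / 2 * \<eta>) * f \<eta>) + d * (\<eta> * exp (v / 2 * \<eta>) * f \<eta>)))"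
    proof (intro Bochner_Integration.integral_cong refl)
      fix \<eta> :: real
      have "exp (- (- v + \<eta>)\<^sup>2 / 4 - A * b * (- v + \<eta>)) = G v * exp (v / 2 * \<eta>) * exp (- \<eta>\<^sup>2 / 4 - A * b * \<eta>)"
        by (simp add: G_def exp_add[symmetric] power2_eq_square field_simps)
      moreover have "u + b * (- v + \<eta>) = b * \<eta>" by (simp add: u algebra_simps)
      ultimately show "(c + d * (- v + \<eta>)) * exp (- (- v + \<eta>)\<^sup>2 / 4 - A * b * (- v + \<eta>)) * \<phi> (u + b * (- v + \<eta>))
        = G v * ((c - d * v) * (exp (v / 2 * \<eta>) * f \<eta>) + d * (\<eta> * exp (v / 2 * \<eta>) * f \<eta>))"
        by (simp add: f_def algebra_simps)
    qed
    also have "\<dots> = G v * ((c - d * v) * M (v / 2) + d * M' (v / 2))"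
      using int[of 1 0 "v / 2"] int[of 0 1 "v / 2"] by (simp add: M_def M'_def)
    finally show ?thesis by (simp add: gauss_avg_def v_def)
  qed
  have "((\<lambda>u. G (u / b) * M (u / b / 2) / (2 * sqrt pi)) has_real_derivative
      (G (u / b) * (A * b - u / b / 2) / b * M (u / b / 2)
        + M' (u / b / 2) * (1 / b / 2) * G (u / b)) / (2 * sqrt pi)) (at u)"
  proof -
    have "((\<lambda>u. M (u / b / 2)) has_real_derivative M' (u / b / 2) * (1 / b / 2)) (at u)"
      by (rule DERIV_chain2[OF M]) (auto intro!: derivative_eq_intros simp: b)
    moreover have "((\<lambda>u. G (u / b)) has_real_derivative G (u / b) * (A * b - u / b / 2) / b) (at u)"
      unfolding G_def using b
      by (auto intro!: derivative_eq_intros simp: field_simps power2_eq_square)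
    ultimately show ?thesis
      by (intro DERIV_cdivide DERIV_cong[OF DERIV_mult]) (auto simp: algebra_simps)
  qed
  moreover have "gauss_avg 1 0 A b \<phi> = (\<lambda>u. G (u / b) * M (u / b / 2) / (2 * sqrt pi))"
    by (rule ext) (simp add: shift)
  moreover have "gauss_avg A (1 / (2 * b)) A b \<phi> u = (G (u / b) * (A * b - u / b / 2) / b * M (u / b / 2)
        + M' (u / b / 2) * (1 / b / 2) * G (u / b)) / (2 * sqrt pi)"
    unfolding shift using b by (simp add: field_simps)
  ultimately show ?thesis by simp
qed

text \<open>Multiplying by exp (p * s) recentres the Gaussian at 2 * (p - A) * b; after translation
  to that centre the triangle inequality suffices, and \<open>B\<close> is a normalised first
  absolute moment. Keeping the centre inside the absolute value matters: for (c, d) = (A, 1 / (2 *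
  b)) that quantity is just p, so that only the term with \<open>B\<close> is singular as b tends to
  0.\<close>

lemma gauss_avg_abs_exp_le:
  "\<exists>B\<ge>0. \<forall>A b c d p u. (LBINT \<eta>. \<bar>c + d * \<eta>\<bar> * exp (- \<eta>\<^sup>2 / 4 - A * b * \<eta>) * exp (p * (u + b * \<eta>))) / (2 * sqrt pi)
     \<le> exp (p * u) * exp ((p - A)\<^sup>2 * b\<^sup>2) * (\<bar>c + 2 * d * (p - A) * b\<bar> + B * \<bar>d\<bar>)"
proof (intro exI conjI allI)
  let ?B = "(LBINT \<xi>. \<bar>\<xi>\<bar> * exp (- \<xi>\<^sup>2 / 4)) / (2 * sqrt pi)"
  show "0 \<le> ?B" by simp
  fix A b c d p u :: real
  define t where "t = 2 * (p - A) * b"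
  define E where "E = exp (p * u) * exp ((p - A)\<^sup>2 * b\<^sup>2)"
  have i0: "integrable lborel (\<lambda>\<xi>. exp (- \<xi>\<^sup>2 / 4) :: real)"
    "(LBINT \<xi>. exp (- \<xi>\<^sup>2 / 4)) = 2 * sqrt pi"
    using has_bochner_integral_gauss_exp[of 0] by (simp_all add: has_bochner_integral_iff)
  have i1: "integrable lborel (\<lambda>\<xi>. \<bar>\<xi>\<bar> * exp (- \<xi>\<^sup>2 / 4) :: real)"
    using integrable_abs[OF integrable_affine_gauss[OF exp_growth_exp[of 0], of 0 1 0 0 0]]
    by (simp add: abs_mult)
  have "(LBINT \<eta>. \<bar>c + d * \<eta>\<bar> * exp (- \<eta>\<^sup>2 / 4 - A * b * \<eta>) * exp (p * (u + b * \<eta>)))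
     = (LBINT \<xi>. \<bar>c + d * (t + \<xi>)\<bar> * exp (- (t + \<xi>)\<^sup>2 / 4 - A * b * (t + \<xi>)) * exp (p * (u + b * (t + \<xi>))))"
    by (subst lborel_integral_real_affine[where c = 1 and t = t]) simp_all
  also have "\<dots> = (LBINT \<xi>. E * (\<bar>(c + d * t) + d * \<xi>\<bar> * exp (- \<xi>\<^sup>2 / 4)))"
  proof (intro Bochner_Integration.integral_cong refl)
    fix \<xi> :: real
    have "exp (- (t + \<xi>)\<^sup>2 / 4 - A * b * (t + \<xi>)) * exp (p * (u + b * (t + \<xi>))) = E * exp (- \<xi>\<^sup>2 / 4)"
      unfolding E_def exp_add[symmetric] t_def
      by (intro arg_cong[where f = exp]) (simp add: power2_eq_square field_simps)
    then show "\<bar>c + d * (t + \<xi>)\<bar> * exp (- (t + \<xi>)\<^sup>2 / 4 - A * b * (t + \<xi>)) * exp (p * (u + b * (t + \<xi>)))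
      = E * (\<bar>(c + d * t) + d * \<xi>\<bar> * exp (- \<xi>\<^sup>2 / 4))"
      by (simp add: algebra_simps)
  qed
  also have "\<dots> \<le> (LBINT \<xi>. E * (\<bar>c + d * t\<bar> * exp (- \<xi>\<^sup>2 / 4) + \<bar>d\<bar> * (\<bar>\<xi>\<bar> * exp (- \<xi>\<^sup>2 / 4))))"
  proof (rule integral_mono)
    show "integrable lborel (\<lambda>\<xi>. E * (\<bar>(c + d * t) + d * \<xi>\<bar> * exp (- \<xi>\<^sup>2 / 4)))"
      using integrable_abs[OF integrable_affine_gauss[OF exp_growth_exp[of 0], of "c + d * t" d 0 0 0]]
      by (simp add: abs_mult)
    show "integrable lborel (\<lambda>\<xi>. E * (\<bar>c + d * t\<bar> * exp (- \<xi>\<^sup>2 / 4) + \<bar>d\<bar> * (\<bar>\<xi>\<bar> * exp (- \<xi>\<^sup>2 / 4))))"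
      using i0(1) i1 by (intro integrable_mult_right Bochner_Integration.integrable_add)
    fix \<xi> :: real
    have "\<bar>(c + d * t) + d * \<xi>\<bar> * exp (- \<xi>\<^sup>2 / 4) \<le> (\<bar>c + d * t\<bar> + \<bar>d\<bar> * \<bar>\<xi>\<bar>) * exp (- \<xi>\<^sup>2 / 4)"
      by (intro mult_right_mono order_trans[OF abs_triangle_ineq]) (auto simp: abs_mult)
    then show "E * (\<bar>(c + d * t) + d * \<xi>\<bar> * exp (- \<xi>\<^sup>2 / 4))
        \<le> E * (\<bar>c + d * t\<bar> * exp (- \<xi>\<^sup>2 / 4) + \<bar>d\<bar> * (\<bar>\<xi>\<bar> * exp (- \<xi>\<^sup>2 / 4)))"
      unfolding E_def by (intro mult_left_mono) (auto simp: algebra_simps)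
  qed
  also have "\<dots> = E * (\<bar>c + d * t\<bar> * (2 * sqrt pi) + \<bar>d\<bar> * (?B * (2 * sqrt pi)))"
    using i0 i1 by simp
  finally show "(LBINT \<eta>. \<bar>c + d * \<eta>\<bar> * exp (- \<eta>\<^sup>2 / 4 - A * b * \<eta>) * exp (p * (u + b * \<eta>))) / (2 * sqrt pi)
     \<le> exp (p * u) * exp ((p - A)\<^sup>2 * b\<^sup>2) * (\<bar>c + 2 * d * (p - A) * b\<bar> + ?B * \<bar>d\<bar>)"
    by (simp add: E_def t_def divide_le_eq algebra_simps)
qed

section \<open>The averages at horizon t in the coordinate u = ln y, and their derivatives in
  u\<close>

definition flow :: "real \<Rightarrow> real \<Rightarrow> real \<Rightarrow> (real \<Rightarrow> real) \<Rightarrow> real \<Rightarrow> real \<Rightarrow> real" where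
  "flow \<alpha> a \<beta> \<phi> u t = exp (\<beta> * t) * gauss_avg 1 0 (\<alpha> - 1) (a * sqrt t) \<phi> u"

definition flow_deriv :: "real \<Rightarrow> real \<Rightarrow> real \<Rightarrow> (real \<Rightarrow> real) \<Rightarrow> real \<Rightarrow> real \<Rightarrow> real" where
  "flow_deriv \<alpha> a \<beta> \<phi> u t =
     exp (\<beta> * t) * gauss_avg (\<alpha> - 1) (1 / (2 * (a * sqrt t))) (\<alpha> - 1) (a * sqrt t) \<phi> u"

text \<open>This is \<lambda>(m) with \<alpha>, a and \<beta> left as free parameters.\<close>

definition growth_rate :: "real \<Rightarrow> real \<Rightarrow> real \<Rightarrow> real \<Rightarrow> real" where
  "growth_rate \<alpha> a \<beta> m = \<beta> + (\<alpha> - m)\<^sup>2 * a\<^sup>2"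

lemma flow_exp:
  assumes "0 \<le> t"
  shows "flow \<alpha> a \<beta> (\<lambda>s. exp ((m - 1) * s)) u t = exp ((m - 1) * u + growth_rate \<alpha> a \<beta> m * t)"
  unfolding flow_def gauss_avg_exp growth_rate_def using assms
  by (simp add: exp_add[symmetric] power_mult_distrib power2_commute[of m \<alpha>] algebra_simps)

lemma has_real_derivative_flow:
  assumes "exp_growth \<phi>" "a \<noteq> 0" "0 < t"
  shows "((\<lambda>u. flow \<alpha> a \<beta> \<phi> u t) has_real_derivative flow_deriv \<alpha> a \<beta> \<phi> u t) (at u)"
  unfolding flow_def flow_deriv_def using assms
  by (intro DERIV_cmult has_real_derivative_gauss_avg) auto

text \<open>No integral is evaluated: both sides are derivatives in u of the explicit
  \<open>flow_exp\<close>.\<close>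

lemma flow_deriv_exp:
  assumes "a \<noteq> 0" "0 < t"
  shows "flow_deriv \<alpha> a \<beta> (\<lambda>s. exp ((m - 1) * s)) u t
      = (m - 1) * exp ((m - 1) * u + growth_rate \<alpha> a \<beta> m * t)"
proof (rule DERIV_unique)
  show "((\<lambda>u. flow \<alpha> a \<beta> (\<lambda>s. exp ((m - 1) * s)) u t)
      has_real_derivative flow_deriv \<alpha> a \<beta> (\<lambda>s. exp ((m - 1) * s)) u t) (at u)"
    by (rule has_real_derivative_flow) (use assms exp_growth_exp in auto)
  show "((\<lambda>u. flow \<alpha> a \<beta> (\<lambda>s. exp ((m - 1) * s)) u t)
      has_real_derivative (m - 1) * exp ((m - 1) * u + growth_rate \<alpha> a \<beta> m * t)) (at u)"
    using assms by (subst flow_exp) (auto intro!: derivative_eq_intros)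
qed

lemma gauss_avg_diff:
  assumes "exp_growth f" "exp_growth g"
  shows "gauss_avg c d A b (\<lambda>s. f s - g s) u = gauss_avg c d A b f u - gauss_avg c d A b g u"
  using integrable_affine_gauss[OF assms(1), of c d "A * b" u b]
    integrable_affine_gauss[OF assms(2), of c d "A * b" u b]
  by (simp add: gauss_avg_def right_diff_distrib diff_divide_distrib)

lemma exp_growth_diff:
  assumes "exp_growth f" "exp_growth g"
  shows "exp_growth (\<lambda>s. f s - g s)"
proof -
  obtain C k where f: "0 \<le> C" "0 \<le> k" "\<And>s. \<bar>f s\<bar> \<le> C * exp (k * \<bar>s\<bar>)"
    using exp_growth_obtain[OF assms(1)] by blast
  obtain C' k' where g: "0 \<le> C'" "0 \<le> k'" "\<And>s. \<bar>g s\<bar> \<le> C' * exp (k' * \<bar>s\<bar>)"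
    using exp_growth_obtain[OF assms(2)] by blast
  have "\<bar>f s - g s\<bar> \<le> (C + C') * exp ((k + k') * \<bar>s\<bar>)" for s
  proof -
    have "\<bar>f s - g s\<bar> \<le> C * exp (k * \<bar>s\<bar>) + C' * exp (k' * \<bar>s\<bar>)"
      using f(3)[of s] g(3)[of s] by linarith
    also have "\<dots> \<le> C * exp ((k + k') * \<bar>s\<bar>) + C' * exp ((k + k') * \<bar>s\<bar>)"
      using f g by (intro add_mono mult_left_mono) (auto intro!: mult_right_mono)
    finally show ?thesis by (simp add: algebra_simps)
  qed
  then show ?thesis
    using assms unfolding exp_growth_def by (auto intro!: continuous_intros)
qed

lemma gauss_avg_bound:
  assumes h: "exp_growth h" "\<And>s. \<bar>h s\<bar> \<le> \<epsilon> * exp (p * s) + C * exp (p' * s)"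
  shows "\<bar>gauss_avg c d A b h u\<bar> \<le>
     \<epsilon> * ((LBINT \<eta>. \<bar>c + d * \<eta>\<bar> * exp (- \<eta>\<^sup>2 / 4 - A * b * \<eta>) * exp (p * (u + b * \<eta>))) / (2 * sqrt pi))
   + C * ((LBINT \<eta>. \<bar>c + d * \<eta>\<bar> * exp (- \<eta>\<^sup>2 / 4 - A * b * \<eta>) * exp (p' * (u + b * \<eta>))) / (2 * sqrt pi))"
proof -
  let ?k = "\<lambda>\<eta>. \<bar>c + d * \<eta>\<bar> * exp (- \<eta>\<^sup>2 / 4 - A * b * \<eta>)"
  have int: "integrable lborel (\<lambda>\<eta>. ?k \<eta> * \<bar>f (u + b * \<eta>)\<bar>)" if "exp_growth f" for f
    using integrable_abs[OF integrable_affine_gauss[OF that, of c d "A * b" u b]] by (simp add: abs_mult)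
  have inte: "integrable lborel (\<lambda>\<eta>. ?k \<eta> * exp (p * (u + b * \<eta>)))" for p
    using int[OF exp_growth_exp[of p]] by simp
  have "\<bar>LBINT \<eta>. (c + d * \<eta>) * exp (- \<eta>\<^sup>2 / 4 - A * b * \<eta>) * h (u + b * \<eta>)\<bar>
      \<le> (LBINT \<eta>. \<bar>(c + d * \<eta>) * exp (- \<eta>\<^sup>2 / 4 - A * b * \<eta>) * h (u + b * \<eta>)\<bar>)"
    by (rule integral_abs_bound)
  also have "\<dots> \<le> (LBINT \<eta>. \<epsilon> * (?k \<eta> * exp (p * (u + b * \<eta>))) + C * (?k \<eta> * exp (p' * (u + b * \<eta>))))"
  proof (rule integral_mono)
    show "integrable lborel (\<lambda>\<eta>. \<bar>(c + d * \<eta>) * exp (- \<eta>\<^sup>2 / 4 - A * b * \<eta>) * h (u + b * \<eta>)\<bar>)"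
      using int[OF h(1)] by (simp add: abs_mult)
    show "integrable lborel (\<lambda>\<eta>. \<epsilon> * (?k \<eta> * exp (p * (u + b * \<eta>))) + C * (?k \<eta> * exp (p' * (u + b * \<eta>))))"
      by (intro Bochner_Integration.integrable_add integrable_mult_right inte)
    fix \<eta>
    have "?k \<eta> * \<bar>h (u + b * \<eta>)\<bar> \<le> ?k \<eta> * (\<epsilon> * exp (p * (u + b * \<eta>)) + C * exp (p' * (u + b * \<eta>)))"
      by (intro mult_left_mono h) auto
    then show "\<bar>(c + d * \<eta>) * exp (- \<eta>\<^sup>2 / 4 - A * b * \<eta>) * h (u + b * \<eta>)\<bar>
        \<le> \<epsilon> * (?k \<eta> * exp (p * (u + b * \<eta>))) + C * (?k \<eta> * exp (p' * (u + b * \<eta>)))"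
      by (simp only: abs_mult abs_exp_cancel distrib_left mult_ac)
  qed
  also have "\<dots> = \<epsilon> * (LBINT \<eta>. ?k \<eta> * exp (p * (u + b * \<eta>))) + C * (LBINT \<eta>. ?k \<eta> * exp (p' * (u + b * \<eta>)))"
    using inte by simp
  finally show ?thesis
    by (simp add: gauss_avg_def abs_mult divide_le_eq algebra_simps)
qed

text \<open>The factor \<open>1 / sqrt t\<close> is the price of differentiating the heat kernel; it stays integrable
  at \<open>t = 0\<close>.\<close>

lemma flow_bounds:
  assumes "a \<noteq> 0"
  shows "\<exists>K\<ge>0. \<forall>h \<epsilon> C u t. exp_growth h \<longrightarrow> 0 \<le> \<epsilon> \<longrightarrow> 0 \<le> C \<longrightarrow> 0 < t \<longrightarrow>
      (\<forall>s. \<bar>h s\<bar> \<le> \<epsilon> * exp ((q - 1) * s) + C * exp ((m - 1) * s)) \<longrightarrow>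
      max \<bar>flow \<alpha> a \<beta> h u t\<bar> \<bar>flow_deriv \<alpha> a \<beta> h u t\<bar> \<le> K * (1 + 1 / sqrt t) *
        (\<epsilon> * exp ((q - 1) * u + growth_rate \<alpha> a \<beta> q * t) + C * exp ((m - 1) * u + growth_rate \<alpha> a \<beta> m * t))"
proof -
  obtain B where B: "0 \<le> B" and Bb: "\<And>A b c d p u.
      (LBINT \<eta>. \<bar>c + d * \<eta>\<bar> * exp (- \<eta>\<^sup>2 / 4 - A * b * \<eta>) * exp (p * (u + b * \<eta>))) / (2 * sqrt pi)
     \<le> exp (p * u) * exp ((p - A)\<^sup>2 * b\<^sup>2) * (\<bar>c + 2 * d * (p - A) * b\<bar> + B * \<bar>d\<bar>)"
    using gauss_avg_abs_exp_le by blast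
  \<comment> \<open>The 1 serves the flow itself. For its derivative,
    \<open>\<bar>q - 1\<bar>\<close> and \<open>\<bar>m - 1\<bar>\<close> come from the centres of
    the two tilted Gaussians, and B / (2 * \<open>\<bar>a\<bar>\<close>) is the coefficient of 1 /
    sqrt t in B * \<open>\<bar>d\<bar>\<close>.\<close>
  define K where "K = 1 + \<bar>q - 1\<bar> + \<bar>m - 1\<bar> + B / (2 * \<bar>a\<bar>)"
  have K: "0 \<le> K" using B by (simp add: K_def)
  have one: "exp (\<beta> * t) * ((LBINT \<eta>. \<bar>c + d * \<eta>\<bar> * exp (- \<eta>\<^sup>2 / 4 - (\<alpha> - 1) * b * \<eta>) * exp ((p - 1) * (u + b * \<eta>))) / (2 * sqrt pi))
      \<le> K * (1 + 1 / sqrt t) * exp ((p - 1) * u + growth_rate \<alpha> a \<beta> p * t)"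
    if t: "0 < t" and b: "b = a * sqrt t" and cd: "c = 1 \<and> d = 0 \<or> c = \<alpha> - 1 \<and> d = 1 / (2 * b)"
      and p: "p \<in> {q, m}"
    for t u b c d p
  proof -
    have b0: "b \<noteq> 0" using b t assms by simp
    have K2: "\<bar>p - 1\<bar> + B / (2 * \<bar>a\<bar>) * (1 / sqrt t) \<le> K * (1 + 1 / sqrt t)"
    proof -
      have "\<bar>p - 1\<bar> \<le> K" "B / (2 * \<bar>a\<bar>) \<le> K" using p B by (auto simp: K_def)
      then have "\<bar>p - 1\<bar> + B / (2 * \<bar>a\<bar>) * (1 / sqrt t) \<le> K + K * (1 / sqrt t)"
        using t by (intro add_mono mult_right_mono) auto
      then show ?thesis by (simp add: algebra_simps)
    qed
    have K1: "1 \<le> K * (1 + 1 / sqrt t)"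
    proof -
      have "1 * 1 \<le> K * (1 + 1 / sqrt t)"
        using t B by (intro mult_mono) (auto simp: K_def)
      then show ?thesis by simp
    qed
    have fac: "\<bar>c + 2 * d * (p - 1 - (\<alpha> - 1)) * b\<bar> + B * \<bar>d\<bar> \<le> K * (1 + 1 / sqrt t)"
      using cd
    proof
      assume *: "c = \<alpha> - 1 \<and> d = 1 / (2 * b)"
      have "B * \<bar>d\<bar> = B / (2 * \<bar>a\<bar>) * (1 / sqrt t)"
        using t * by (simp add: b abs_mult)
      moreover have "c + 2 * d * (p - 1 - (\<alpha> - 1)) * b = p - 1"
        using * b0 by simp
      ultimately show ?thesis using K2 by (simp only:)
    qed (use K1 in simp)
    have e: "exp (\<beta> * t) * (exp ((p - 1) * u) * exp ((p - 1 - (\<alpha> - 1))\<^sup>2 * b\<^sup>2)) = exp ((p - 1) * u + growth_rate \<alpha> a \<beta> p * t)"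
      using t by (simp add: b growth_rate_def exp_add[symmetric] power_mult_distrib power2_commute[of p \<alpha>] algebra_simps)
    have "exp (\<beta> * t) * ((LBINT \<eta>. \<bar>c + d * \<eta>\<bar> * exp (- \<eta>\<^sup>2 / 4 - (\<alpha> - 1) * b * \<eta>) * exp ((p - 1) * (u + b * \<eta>))) / (2 * sqrt pi))
      \<le> exp (\<beta> * t) * (exp ((p - 1) * u) * exp ((p - 1 - (\<alpha> - 1))\<^sup>2 * b\<^sup>2) * (\<bar>c + 2 * d * (p - 1 - (\<alpha> - 1)) * b\<bar> + B * \<bar>d\<bar>))"
      by (intro mult_left_mono Bb) auto
    also have "\<dots> = exp ((p - 1) * u + growth_rate \<alpha> a \<beta> p * t) * (\<bar>c + 2 * d * (p - 1 - (\<alpha> - 1)) * b\<bar> + B * \<bar>d\<bar>)"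
      unfolding e[symmetric] by (simp only: mult.assoc)
    also have "\<dots> \<le> exp ((p - 1) * u + growth_rate \<alpha> a \<beta> p * t) * (K * (1 + 1 / sqrt t))"
      by (intro mult_left_mono fac) auto
    finally show ?thesis by (simp only: mult_ac)
  qed
  show ?thesis
  proof (intro exI[of _ K] conjI allI impI K)
    fix h and \<epsilon> C u t :: real
    assume h: "exp_growth h" and eC: "0 \<le> \<epsilon>" "0 \<le> C" and t: "0 < t"
      and hb: "\<forall>s. \<bar>h s\<bar> \<le> \<epsilon> * exp ((q - 1) * s) + C * exp ((m - 1) * s)"
    define b where "b = a * sqrt t"
    have "exp (\<beta> * t) * \<bar>gauss_avg c d (\<alpha> - 1) b h u\<bar> \<le> K * (1 + 1 / sqrt t) *
        (\<epsilon> * exp ((q - 1) * u + growth_rate \<alpha> a \<beta> q * t) + C * exp ((m - 1) * u + growth_rate \<alpha> a \<beta> m * t))"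
      if cd: "c = 1 \<and> d = 0 \<or> c = \<alpha> - 1 \<and> d = 1 / (2 * b)" for c d
    proof -
      define L where "L p = (LBINT \<eta>. \<bar>c + d * \<eta>\<bar> * exp (- \<eta>\<^sup>2 / 4 - (\<alpha> - 1) * b * \<eta>) * exp ((p - 1) * (u + b * \<eta>))) / (2 * sqrt pi)" for p
      have "exp (\<beta> * t) * \<bar>gauss_avg c d (\<alpha> - 1) b h u\<bar> \<le> exp (\<beta> * t) * (\<epsilon> * L q + C * L m)"
        unfolding L_def by (intro mult_left_mono gauss_avg_bound h) (use hb in auto)
      also have "\<dots> = \<epsilon> * (exp (\<beta> * t) * L q) + C * (exp (\<beta> * t) * L m)" by (simp add: algebra_simps)
      also have "\<dots> \<le> \<epsilon> * (K * (1 + 1 / sqrt t) * exp ((q - 1) * u + growth_rate \<alpha> a \<beta> q * t))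
          + C * (K * (1 + 1 / sqrt t) * exp ((m - 1) * u + growth_rate \<alpha> a \<beta> m * t))"
        unfolding L_def by (intro add_mono mult_left_mono eC one t b_def cd) auto
      finally show ?thesis by (simp only: distrib_left mult_ac)
    qed
    from this[of 1 0] this[of "\<alpha> - 1" "1 / (2 * b)"]
    show "max \<bar>flow \<alpha> a \<beta> h u t\<bar> \<bar>flow_deriv \<alpha> a \<beta> h u t\<bar> \<le> K * (1 + 1 / sqrt t) *
        (\<epsilon> * exp ((q - 1) * u + growth_rate \<alpha> a \<beta> q * t) + C * exp ((m - 1) * u + growth_rate \<alpha> a \<beta> m * t))"
      by (simp add: flow_def flow_deriv_def b_def abs_mult)
  qed
qed

lemma measurable_flow:
  assumes "exp_growth \<phi>"
  shows "flow \<alpha> a \<beta> \<phi> u \<in> borel_measurable borel" "flow_deriv \<alpha> a \<beta> \<phi> u \<in> borel_measurable borel"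
proof -
  note [measurable] = exp_growth_measurable[OF assms]
  show "flow \<alpha> a \<beta> \<phi> u \<in> borel_measurable borel"
    unfolding flow_def[abs_def] gauss_avg_def by measurable
  show "flow_deriv \<alpha> a \<beta> \<phi> u \<in> borel_measurable borel"
    unfolding flow_deriv_def[abs_def] gauss_avg_def by measurable
qed

section \<open>Integration over the time horizon\<close>


text \<open>The half-open interval is chosen because the flow estimates are available at positive
  times only; the left endpoint is a null set.\<close>

lemma set_integral_exp:
  assumes "0 \<le> t"
  shows "set_integrable lborel {0<..t} (\<lambda>\<tau>. exp (l * \<tau>) :: real)"
    and "(LBINT \<tau>:{0<..t}. exp (l * \<tau>)) = exp_avg l t"
proof -
  have "set_integrable lborel {0..t} (\<lambda>\<tau>. exp (l * \<tau>) :: real)"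
    by (intro borel_integrable_atLeastAtMost') (auto intro!: continuous_intros)
  then show "set_integrable lborel {0<..t} (\<lambda>\<tau>. exp (l * \<tau>) :: real)"
    by (rule set_integrable_subset) auto
  have "(LBINT \<tau>:{0..t}. exp (l * \<tau>)) = exp_avg l t"
  proof (cases "l = 0")
    case True
    then show ?thesis
      using assms by (simp add: exp_avg_def set_lebesgue_integral_def)
  next
    case False
    have "(LBINT \<tau>. indicator {0..t} \<tau> *\<^sub>R exp (l * \<tau>)) = exp (l * t) / l - exp (l * 0) / l"
      using False assms
      by (intro integral_FTC_atLeastAtMost)
        (auto intro!: derivative_eq_intros continuous_intros
          simp: has_real_derivative_iff_has_vector_derivative[symmetric])
    then show ?thesis
      using False by (simp add: exp_avg_def set_lebesgue_integral_def diff_divide_distrib)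
  qed
  moreover have "(LBINT \<tau>:{0..t}. exp (l * \<tau>)) = (LBINT \<tau>:{0<..t}. exp (l * \<tau>))"
    using AE_lborel_singleton[of 0] unfolding set_lebesgue_integral_def
    by (intro integral_cong_AE) (auto simp: indicator_def elim!: eventually_mono)
  ultimately show "(LBINT \<tau>:{0<..t}. exp (l * \<tau>)) = exp_avg l t" by simp
qed

lemma set_integrable_inverse_sqrt:
  "set_integrable lborel {0<..t} (\<lambda>\<tau>. 1 / sqrt \<tau> :: real)"
proof (cases "0 \<le> t")
  case True
  have "(\<lambda>x. x powr (- 1 / 2)) integrable_on {0..t}"
    using True by (intro integrable_on_powr_from_0) auto
  then have "(\<lambda>x. x powr (- 1 / 2)) absolutely_integrable_on {0..t}"
    by (rule nonnegative_absolutely_integrable_1) auto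
  then have "set_integrable lborel {0..t} (\<lambda>x. x powr (- 1 / 2))"
    unfolding set_integrable_def by (subst (asm) integrable_completion) auto
  then have "set_integrable lborel {0<..t} (\<lambda>x. x powr (- 1 / 2))"
    by (rule set_integrable_subset) auto
  then show ?thesis
    by (subst set_integrable_cong[OF refl refl, where f' = "\<lambda>x. x powr (- 1 / 2)"])
      (auto simp: powr_minus_divide powr_half_sqrt)
qed (simp add: set_integrable_def)

lemma set_integrable_weight:
  "set_integrable lborel {0<..t} (\<lambda>\<tau>. (1 + 1 / sqrt \<tau>) * exp (l * \<tau>) :: real)"
proof (rule set_integrable_bound)
  have "set_integrable lborel {0<..t} (\<lambda>_. 1 :: real)"
    unfolding set_integrable_def by (cases "0 \<le> t") (auto intro!: integrable_real_indicator)
  then show "set_integrable lborel {0<..t} (\<lambda>\<tau>. exp (\<bar>l\<bar> * t) * (1 + 1 / sqrt \<tau>) :: real)"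
    by (intro set_integrable_mult_right set_integral_add set_integrable_inverse_sqrt) auto
  show "set_borel_measurable lborel {0<..t} (\<lambda>\<tau>. (1 + 1 / sqrt \<tau>) * exp (l * \<tau>))"
    unfolding set_borel_measurable_def by measurable
  show "AE \<tau> in lborel. \<tau> \<in> {0<..t} \<longrightarrow> norm ((1 + 1 / sqrt \<tau>) * exp (l * \<tau>))
      \<le> norm (exp (\<bar>l\<bar> * t) * (1 + 1 / sqrt \<tau>))"
  proof (rule AE_I2, rule impI)
    fix \<tau> assume \<tau>: "\<tau> \<in> {0<..t}"
    have "l * \<tau> \<le> \<bar>l\<bar> * t" using \<tau> by (intro mult_mono) auto
    then have "(1 + 1 / sqrt \<tau>) * exp (l * \<tau>) \<le> (1 + 1 / sqrt \<tau>) * exp (\<bar>l\<bar> * t)"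
      using \<tau> by (intro mult_left_mono) auto
    then show "norm ((1 + 1 / sqrt \<tau>) * exp (l * \<tau>)) \<le> norm (exp (\<bar>l\<bar> * t) * (1 + 1 / sqrt \<tau>))"
      using \<tau> by (simp add: abs_mult mult.commute)
  qed
qed

text \<open>The part of the integral over (0, 1] alone gives the bound, whatever the sign of l. It
  permits absorbing additive constants into multiples of \<open>exp_avg l t\<close>.\<close>

lemma exp_avg_ge_exp_neg:
  assumes "1 \<le> t"
  shows "exp (- \<bar>l\<bar>) \<le> exp_avg l t"
proof -
  have "exp (- \<bar>l\<bar>) = (LBINT \<tau>:{0<..(1::real)}. exp (- \<bar>l\<bar>))"
    by (simp add: set_lebesgue_integral_def measure_def)
  also have "\<dots> \<le> (LBINT \<tau>:{0<..1}. exp (l * \<tau>))"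
  proof (rule set_integral_mono)
    show "set_integrable lborel {0<..1} (\<lambda>\<tau>::real. exp (- \<bar>l\<bar>))"
      unfolding set_integrable_def by (auto intro!: integrable_real_indicator)
    show "set_integrable lborel {0<..1} (\<lambda>\<tau>. exp (l * \<tau>))" by (rule set_integral_exp) simp
    fix \<tau> :: real assume "\<tau> \<in> {0<..1}"
    then have "\<bar>l * \<tau>\<bar> \<le> \<bar>l\<bar> * 1" unfolding abs_mult by (intro mult_left_mono) auto
    then show "exp (- \<bar>l\<bar>) \<le> exp (l * \<tau>)" by simp
  qed
  also have "\<dots> \<le> (LBINT \<tau>:{0<..t}. exp (l * \<tau>))"
    unfolding set_lebesgue_integral_def
    using set_integral_exp(1)[of 1 l] set_integral_exp(1)[of t l] assms
    by (intro integral_mono) (auto simp: set_integrable_def indicator_def)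
  finally show ?thesis using assms by (simp add: set_integral_exp)
qed

text \<open>Beyond 1 the weight is at most 2, and the singular part over (0, 1] is a constant,
  absorbed by means of \<open>exp_avg_ge_exp_neg\<close>. Thus the factor 1 / sqrt \<tau> costs only
  a constant after integration.\<close>

lemma weight_integral_le:
  "\<exists>D\<ge>0. \<forall>t\<ge>1. (LBINT \<tau>:{0<..t}. (1 + 1 / sqrt \<tau>) * exp (l * \<tau>)) \<le> D * exp_avg l t"
proof (intro exI conjI allI impI)
  define c where "c = (LBINT \<tau>:{0<..1}. (1 + 1 / sqrt \<tau>) * exp (l * \<tau>))"
  have c: "0 \<le> c" unfolding c_def set_lebesgue_integral_def
    by (intro integral_nonneg_AE) (auto simp: indicator_def)
  show "0 \<le> 2 + c * exp \<bar>l\<bar>" using c by simp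
  fix t :: real assume t: "1 \<le> t"
  have "(LBINT \<tau>:{0<..t}. (1 + 1 / sqrt \<tau>) * exp (l * \<tau>))
      \<le> (LBINT \<tau>. indicator {0<..1} \<tau> *\<^sub>R ((1 + 1 / sqrt \<tau>) * exp (l * \<tau>)) + 2 * (indicator {0<..t} \<tau> *\<^sub>R exp (l * \<tau>)))"
    unfolding set_lebesgue_integral_def
  proof (rule integral_mono)
    show "integrable lborel (\<lambda>\<tau>. indicator {0<..t} \<tau> *\<^sub>R ((1 + 1 / sqrt \<tau>) * exp (l * \<tau>)))"
      using set_integrable_weight[of t l] by (simp add: set_integrable_def)
    show "integrable lborel (\<lambda>\<tau>. indicator {0<..1} \<tau> *\<^sub>R ((1 + 1 / sqrt \<tau>) * exp (l * \<tau>)) + 2 * (indicator {0<..t} \<tau> *\<^sub>R exp (l * \<tau>)))"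
      using set_integrable_weight[of 1 l] set_integral_exp(1)[of t l] t
      by (intro Bochner_Integration.integrable_add integrable_mult_right) (auto simp: set_integrable_def)
    fix \<tau> :: real
    have "(1 + 1 / sqrt \<tau>) * exp (l * \<tau>) \<le> 2 * exp (l * \<tau>)" if "1 < \<tau>"
      using that by (intro mult_right_mono) auto
    then show "indicator {0<..t} \<tau> *\<^sub>R ((1 + 1 / sqrt \<tau>) * exp (l * \<tau>))
       \<le> indicator {0<..1} \<tau> *\<^sub>R ((1 + 1 / sqrt \<tau>) * exp (l * \<tau>)) + 2 * (indicator {0<..t} \<tau> *\<^sub>R exp (l * \<tau>))"
      by (cases "\<tau> \<le> 1") (auto simp: indicator_def)
  qed
  also have "\<dots> = c + 2 * exp_avg l t"
    using set_integrable_weight[of 1 l] set_integral_exp[of t l] t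
    by (subst Bochner_Integration.integral_add) (auto simp: set_integrable_def c_def set_lebesgue_integral_def)
  also have "c \<le> c * exp \<bar>l\<bar> * exp_avg l t"
  proof -
    have "1 = exp \<bar>l\<bar> * exp (- \<bar>l\<bar>)" by (simp add: exp_add[symmetric])
    also have "\<dots> \<le> exp \<bar>l\<bar> * exp_avg l t" by (intro mult_left_mono exp_avg_ge_exp_neg t) auto
    finally show ?thesis using c mult_left_mono[of 1 _ c] by (simp add: mult.assoc)
  qed
  finally show "(LBINT \<tau>:{0<..t}. (1 + 1 / sqrt \<tau>) * exp (l * \<tau>)) \<le> (2 + c * exp \<bar>l\<bar>) * exp_avg l t"
    by (simp add: algebra_simps)
qed

text \<open>The leading term carries an arbitrarily small relative error, and everything else is
  charged to the exponent \<open>m\<close> with a constant that may be large. \<open>C\<close>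
  precedes \<open>u\<close> and \<open>t\<close> in the quantifiers, so that the estimate can be
  used along any path and integrated in time.\<close>

definition asymp_power :: "(real \<Rightarrow> real) \<Rightarrow> (real \<Rightarrow> real \<Rightarrow> real) \<Rightarrow> real \<Rightarrow> real \<Rightarrow> real \<Rightarrow> bool" where
  "asymp_power lam T \<kappa> q m \<longleftrightarrow> (\<forall>\<epsilon>>0. \<exists>C\<ge>0. \<forall>u. \<forall>t>0.
     \<bar>T u t - \<kappa> * exp ((q - 1) * u + lam q * t)\<bar> \<le> (1 + 1 / sqrt t) *
       (\<epsilon> * exp ((q - 1) * u + lam q * t) + C * exp ((m - 1) * u + lam m * t)))"

lemma asymp_power_tendsto:
  assumes T: "asymp_power lam T \<kappa> q m"
    and M: "\<forall>\<^sub>F t in at_top. exp ((q - 1) * u t + lam q * t) \<le> M"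
    and m: "((\<lambda>t. exp ((m - 1) * u t + lam m * t)) \<longlongrightarrow> 0) at_top"
  shows "((\<lambda>t. T (u t) t - \<kappa> * exp ((q - 1) * u t + lam q * t)) \<longlongrightarrow> 0) at_top"
proof (rule tendstoI)
  fix e :: real assume e: "0 < e"
  \<comment> \<open>For t at least 1 the weight is at most 2, so two errors of e / 8 add up to at
    most e / 2. The constant \<open>C\<close> depends on \<epsilon>; only afterwards is t taken
    large enough for the term of exponent \<open>m\<close>.\<close>
  define \<epsilon> where "\<epsilon> = e / (8 * (\<bar>M\<bar> + 1))"
  have "0 < \<epsilon>" using e by (simp add: \<epsilon>_def)
  then obtain C where C: "0 \<le> C" "\<And>u t. 0 < t \<Longrightarrow>
     \<bar>T u t - \<kappa> * exp ((q - 1) * u + lam q * t)\<bar> \<le> (1 + 1 / sqrt t) *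
       (\<epsilon> * exp ((q - 1) * u + lam q * t) + C * exp ((m - 1) * u + lam m * t))"
    using T unfolding asymp_power_def by blast
  have "\<forall>\<^sub>F t in at_top. exp ((m - 1) * u t + lam m * t) < e / (8 * (C + 1))"
    using m by (rule order_tendstoD) (use e C in simp)
  then show "\<forall>\<^sub>F t in at_top. dist (T (u t) t - \<kappa> * exp ((q - 1) * u t + lam q * t)) 0 < e"
    using M eventually_ge_at_top[of 1]
  proof eventually_elim
    case (elim t)
    have "\<epsilon> * exp ((q - 1) * u t + lam q * t) \<le> \<epsilon> * (\<bar>M\<bar> + 1)"
      using elim(2) \<open>0 < \<epsilon>\<close> by (intro mult_left_mono) auto
    also have "\<dots> = e / 8" by (simp add: \<epsilon>_def field_simps)
    finally have 1: "\<epsilon> * exp ((q - 1) * u t + lam q * t) \<le> e / 8" .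
    have "C * exp ((m - 1) * u t + lam m * t) \<le> (C + 1) * (e / (8 * (C + 1)))"
      using elim(1) C(1) by (intro mult_mono) auto
    also have "\<dots> = e / 8" using C(1) by (simp add: field_simps)
    finally have 2: "C * exp ((m - 1) * u t + lam m * t) \<le> e / 8" .
    have "\<bar>T (u t) t - \<kappa> * exp ((q - 1) * u t + lam q * t)\<bar> \<le> (1 + 1 / sqrt t) *
       (\<epsilon> * exp ((q - 1) * u t + lam q * t) + C * exp ((m - 1) * u t + lam m * t))"
      using elim(3) by (intro C) simp
    also have "\<dots> \<le> 2 * (e / 8 + e / 8)"
    proof (rule mult_mono)
      show "1 + 1 / sqrt t \<le> 2" using elim(3) by simp
      show "\<epsilon> * exp ((q - 1) * u t + lam q * t) + C * exp ((m - 1) * u t + lam m * t) \<le> e / 8 + e / 8"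
        by (rule add_mono[OF 1 2])
      show "0 \<le> \<epsilon> * exp ((q - 1) * u t + lam q * t) + C * exp ((m - 1) * u t + lam m * t)"
        using C(1) \<open>0 < \<epsilon>\<close> by simp
    qed simp
    finally show ?case using e by (simp add: dist_real_def)
  qed
qed

text \<open>In the integral over \<tau> the point \<open>u t\<close> is frozen, so the powers of exp
  (\<open>u t\<close>) factor out, exp (\<open>lam q\<close> * \<tau>) integrates to
  \<open>exp_avg\<close>, and the weights cost the constants \<open>D\<close> and
  \<open>D'\<close>.\<close>

lemma asymp_power_integral_tendsto:
  assumes T: "asymp_power lam T \<kappa> q m"
    and int: "\<And>u t. set_integrable lborel {0<..t} (T u)"
    and M: "\<forall>\<^sub>F t in at_top. exp ((q - 1) * u t) * exp_avg (lam q) t \<le> M"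
    and m: "((\<lambda>t. exp ((m - 1) * u t) * exp_avg (lam m) t) \<longlongrightarrow> 0) at_top"
  shows "((\<lambda>t. (LBINT \<tau>:{0<..t}. T (u t) \<tau>) - \<kappa> * (exp ((q - 1) * u t) * exp_avg (lam q) t)) \<longlongrightarrow> 0) at_top"
proof (rule tendstoI)
  fix e :: real assume e: "0 < e"
  obtain D where D: "0 \<le> D" "\<And>t. 1 \<le> t \<Longrightarrow>
      (LBINT \<tau>:{0<..t}. (1 + 1 / sqrt \<tau>) * exp (lam q * \<tau>)) \<le> D * exp_avg (lam q) t"
    using weight_integral_le by blast
  obtain D' where D': "0 \<le> D'" "\<And>t. 1 \<le> t \<Longrightarrow>
      (LBINT \<tau>:{0<..t}. (1 + 1 / sqrt \<tau>) * exp (lam m * \<tau>)) \<le> D' * exp_avg (lam m) t"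
    using weight_integral_le by blast
  define \<epsilon> where "\<epsilon> = e / (4 * (D + 1) * (\<bar>M\<bar> + 1))"
  have "0 < \<epsilon>" using e D by (simp add: \<epsilon>_def)
  then obtain C where C: "0 \<le> C" "\<And>u t. 0 < t \<Longrightarrow>
     \<bar>T u t - \<kappa> * exp ((q - 1) * u + lam q * t)\<bar> \<le> (1 + 1 / sqrt t) *
       (\<epsilon> * exp ((q - 1) * u + lam q * t) + C * exp ((m - 1) * u + lam m * t))"
    using T unfolding asymp_power_def by blast
  have "\<forall>\<^sub>F t in at_top. exp ((m - 1) * u t) * exp_avg (lam m) t < e / (4 * (C * D' + 1))"
    using m by (rule order_tendstoD) (use e C D' in \<open>simp add: add_nonneg_pos\<close>)
  then show "\<forall>\<^sub>F t in at_top. dist ((LBINT \<tau>:{0<..t}. T (u t) \<tau>) - \<kappa> * (exp ((q - 1) * u t) * exp_avg (lam q) t)) 0 < e"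
    using M eventually_ge_at_top[of 1]
  proof eventually_elim
    case (elim t)
    define Ea where "Ea = exp ((q - 1) * u t) * exp_avg (lam q) t"
    define Eb where "Eb = exp ((m - 1) * u t) * exp_avg (lam m) t"
    define wq where "wq \<tau> = (1 + 1 / sqrt \<tau>) * exp (lam q * \<tau>)" for \<tau>
    define wm where "wm \<tau> = (1 + 1 / sqrt \<tau>) * exp (lam m * \<tau>)" for \<tau>
    have iq: "set_integrable lborel {0<..t} wq" and im: "set_integrable lborel {0<..t} wm"
      unfolding wq_def[abs_def] wm_def[abs_def] by (rule set_integrable_weight)+
    have pos: "0 \<le> Ea" "0 \<le> Eb"
      using order_trans[OF _ exp_avg_ge_exp_neg[OF elim(3)]] by (auto simp: Ea_def Eb_def)
    have ie: "set_integrable lborel {0<..t} (\<lambda>\<tau>. \<kappa> * (exp ((q - 1) * u t) * exp (lam q * \<tau>)))"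
      by (intro set_integrable_mult_right set_integral_exp) (use elim in auto)
    have eq: "(LBINT \<tau>:{0<..t}. T (u t) \<tau>) - \<kappa> * Ea
       = (LBINT \<tau>:{0<..t}. T (u t) \<tau> - \<kappa> * (exp ((q - 1) * u t) * exp (lam q * \<tau>)))"
      using int[of t "u t"] ie elim(3) by (simp add: set_integral_diff(2) set_integral_exp(2) Ea_def)
    have "\<bar>(LBINT \<tau>:{0<..t}. T (u t) \<tau>) - \<kappa> * Ea\<bar> \<le> (LBINT \<tau>:{0<..t}. \<bar>T (u t) \<tau> - \<kappa> * (exp ((q - 1) * u t) * exp (lam q * \<tau>))\<bar>)"
      unfolding eq using set_integral_norm_bound[OF set_integral_diff(1)[OF int[of t "u t"] ie]] by simp
    also have "\<dots> \<le> (LBINT \<tau>:{0<..t}. (\<epsilon> * exp ((q - 1) * u t)) * wq \<tau> + (C * exp ((m - 1) * u t)) * wm \<tau>)"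
    proof (rule set_integral_mono)
      show "set_integrable lborel {0<..t} (\<lambda>\<tau>. \<bar>T (u t) \<tau> - \<kappa> * (exp ((q - 1) * u t) * exp (lam q * \<tau>))\<bar>)"
        by (rule set_integrable_abs[OF set_integral_diff(1)[OF int ie]])
      show "set_integrable lborel {0<..t} (\<lambda>\<tau>. (\<epsilon> * exp ((q - 1) * u t)) * wq \<tau> + (C * exp ((m - 1) * u t)) * wm \<tau>)"
        by (rule set_integral_add(1)[OF set_integrable_mult_right[OF iq] set_integrable_mult_right[OF im]])
      show "\<bar>T (u t) \<tau> - \<kappa> * (exp ((q - 1) * u t) * exp (lam q * \<tau>))\<bar>
         \<le> (\<epsilon> * exp ((q - 1) * u t)) * wq \<tau> + (C * exp ((m - 1) * u t)) * wm \<tau>" if "\<tau> \<in> {0<..t}" for \<tau>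
        using C(2)[of \<tau> "u t", unfolded exp_add] that by (simp add: wq_def wm_def algebra_simps)
    qed
    also have "\<dots> = (\<epsilon> * exp ((q - 1) * u t)) * (LBINT \<tau>:{0<..t}. wq \<tau>) + (C * exp ((m - 1) * u t)) * (LBINT \<tau>:{0<..t}. wm \<tau>)"
      using iq im by (simp add: set_integral_add(2))
    also have "\<dots> \<le> (\<epsilon> * exp ((q - 1) * u t)) * (D * exp_avg (lam q) t) + (C * exp ((m - 1) * u t)) * (D' * exp_avg (lam m) t)"
      unfolding wq_def wm_def using elim(3) \<open>0 < \<epsilon>\<close> C(1) by (intro add_mono mult_left_mono D D') auto
    also have "\<dots> = \<epsilon> * (D * Ea) + (C * D') * Eb" by (simp add: Ea_def Eb_def)
    finally have main: "\<bar>(LBINT \<tau>:{0<..t}. T (u t) \<tau>) - \<kappa> * Ea\<bar> \<le> \<epsilon> * (D * Ea) + (C * D') * Eb" .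
    have "Ea \<le> \<bar>M\<bar> + 1" using elim(2) by (simp add: Ea_def)
    then have "\<epsilon> * (D * Ea) \<le> \<epsilon> * ((D + 1) * (\<bar>M\<bar> + 1))"
      using \<open>0 < \<epsilon>\<close> D(1) pos by (intro mult_left_mono mult_mono) simp_all
    also have "\<dots> = e / 4"
    proof -
      have "(D + 1) * (\<bar>M\<bar> + 1) \<noteq> 0" using D(1) by simp
      then show ?thesis unfolding \<epsilon>_def mult.assoc by (simp del: mult_eq_0_iff)
    qed
    finally have 1: "\<epsilon> * (D * Ea) \<le> e / 4" .
    have CD: "0 \<le> C * D'" using C(1) D'(1) by simp
    have "Eb \<le> e / (4 * (C * D' + 1))" using elim(1) by (simp add: Eb_def)
    then have "(C * D') * Eb \<le> (C * D' + 1) * (e / (4 * (C * D' + 1)))"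
      using CD pos by (intro mult_mono) simp_all
    also have "\<dots> = e / 4"
      using CD by (simp add: divide_simps)
    finally have 2: "(C * D') * Eb \<le> e / 4" .
    show ?case using main 1 2 e by (simp add: dist_real_def Ea_def)
  qed
qed

section \<open>The marginal dual function\<close>

lemma dual_fun_bdd_above:
  assumes U: "is_utility U" and y: "0 < y"
  shows "bdd_above ((\<lambda>x. U x - x * y) ` {0..})"
proof -
  obtain C p where C: "0 < C" "0 < p" "p < 1" "\<And>x. 0 \<le> x \<Longrightarrow> U x \<le> C * (1 + x powr p)"
    using U unfolding is_utility_def by auto
  \<comment> \<open>The positive solution of C * x powr p = x * y; to its right the linear cost
    exceeds the power in the growth bound.\<close>
  define X where "X = (C / y) powr (1 / (1 - p))"
  have "U x - x * y \<le> C * (1 + X powr p)" if "0 \<le> x" for x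
  proof (cases "x \<le> X")
    case True
    then have "x powr p \<le> X powr p" using that C by (intro powr_mono2) auto
    then have "C * (1 + x powr p) \<le> C * (1 + X powr p)" using C by simp
    moreover have "0 \<le> x * y" using that y by simp
    ultimately show ?thesis using C(4)[OF that] by linarith
  next
    case False
    then have x: "0 < X" "X < x" using C y by (auto simp: X_def)
    have "C / y = X powr (1 - p)" using C y by (simp add: X_def powr_powr)
    also have "\<dots> \<le> x powr (1 - p)" using x C by (intro powr_mono2) auto
    finally have "C \<le> x powr (1 - p) * y" using y by (simp add: divide_le_eq)
    then have "C * x powr p \<le> x powr (1 - p) * y * x powr p" by (intro mult_right_mono) auto
    also have "\<dots> = x powr (1 - p + p) * y" by (simp only: powr_add mult_ac)
    finally have "C * x powr p \<le> x * y" using x by simp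
    then have "U x - x * y \<le> C" using C(4)[OF that] by (simp add: distrib_left)
    also have "C \<le> C * (1 + X powr p)" using C by simp
    finally show ?thesis .
  qed
  then show ?thesis by (intro bdd_aboveI2) auto
qed

lemma dual_fun_nonneg:
  assumes "is_utility U" "0 < y"
  shows "0 \<le> dual_fun U y"
proof -
  have "U 0 - 0 * y \<le> dual_fun U y"
    unfolding dual_fun_def using dual_fun_bdd_above[OF assms] by (intro cSUP_upper) auto
  then show ?thesis using assms by (simp add: is_utility_def)
qed

lemma dual_fun_antimono:
  assumes "is_utility U" "0 < y" "y \<le> z"
  shows "dual_fun U z \<le> dual_fun U y"
  unfolding dual_fun_def
proof (rule cSUP_mono)
  show "bdd_above ((\<lambda>x. U x - x * y) ` {0..})" by (intro dual_fun_bdd_above assms)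
  show "\<exists>m\<in>{0..}. U n - n * z \<le> U m - m * y" if "n \<in> {0..}" for n
    using that assms by (intro bexI[of _ n]) (auto intro: mult_left_mono)
qed auto

lemma dual_fun_convex:
  assumes "is_utility U"
  shows "convex_on {0<..} (dual_fun U)"
proof (rule convex_onI)
  fix t y z :: real
  assume t: "0 < t" "t < 1" and yz: "y \<in> {0<..}" "z \<in> {0<..}"
  have *: "U x - x * w \<le> dual_fun U w" if "0 \<le> x" "w \<in> {0<..}" for x w
    unfolding dual_fun_def using dual_fun_bdd_above[OF assms, of w] that by (intro cSUP_upper) auto
  show "dual_fun U ((1 - t) *\<^sub>R y + t *\<^sub>R z) \<le> (1 - t) * dual_fun U y + t * dual_fun U z"
    unfolding dual_fun_def[of U "(1 - t) *\<^sub>R y + t *\<^sub>R z"]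
  proof (rule cSUP_least)
    fix x :: real assume x: "x \<in> {0..}"
    have "U x - x * ((1 - t) *\<^sub>R y + t *\<^sub>R z) = (1 - t) * (U x - x * y) + t * (U x - x * z)"
      by (simp add: algebra_simps)
    also have "\<dots> \<le> (1 - t) * dual_fun U y + t * dual_fun U z"
      using * x yz t by (intro add_mono mult_left_mono) auto
    finally show "U x - x * ((1 - t) *\<^sub>R y + t *\<^sub>R z) \<le> \<dots>" .
  qed auto
qed simp

text \<open>The properties of \<open>s \<mapsto> \<bar>V' (exp s)\<bar>\<close>; the last one is where \<open>V \<ge> 0\<close> enters.\<close>

definition marginal :: "(real \<Rightarrow> real) \<Rightarrow> real \<Rightarrow> bool" where
  "marginal \<phi> q \<longleftrightarrow> continuous_on UNIV \<phi> \<and> (\<forall>s. 0 \<le> \<phi> s) \<and> antimono \<phi> \<and>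
     ((\<lambda>s. \<phi> s / exp ((q - 1) * s)) \<longlongrightarrow> 1) at_bot \<and> (\<exists>K. \<forall>s\<ge>0. \<phi> s \<le> K * exp (- s))"

lemma dual_fun_deriv:
  assumes U: "is_utility U" and C1: "dual_fun U C1_differentiable_on {0<..}"
  shows dual_fun_has_deriv: "\<And>y. 0 < y \<Longrightarrow> (dual_fun U has_real_derivative deriv (dual_fun U) y) (at y)"
    and continuous_on_deriv_dual_fun: "continuous_on {0<..} (deriv (dual_fun U))"
    and deriv_dual_fun_nonpos: "\<And>y. 0 < y \<Longrightarrow> deriv (dual_fun U) y \<le> 0"
    and deriv_dual_fun_mono: "\<And>y z. 0 < y \<Longrightarrow> y \<le> z \<Longrightarrow> deriv (dual_fun U) y \<le> deriv (dual_fun U) z"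
    and deriv_dual_fun_ge: "\<And>y. 1 \<le> y \<Longrightarrow> - (2 * dual_fun U (1 / 2) / y) \<le> deriv (dual_fun U) y"
proof -
  obtain D where D: "\<And>y. 0 < y \<Longrightarrow> (dual_fun U has_vector_derivative D y) (at y)" "continuous_on {0<..} D"
    using C1 unfolding C1_differentiable_on_def by auto
  then have D': "(dual_fun U has_real_derivative D y) (at y)" if "0 < y" for y
    using that by (simp add: has_real_derivative_iff_has_vector_derivative)
  have eq: "deriv (dual_fun U) y = D y" if "0 < y" for y
    using D'[OF that] by (rule DERIV_imp_deriv)
  show der: "(dual_fun U has_real_derivative deriv (dual_fun U) y) (at y)" if "0 < y" for y
    using D'[OF that] eq[OF that] by simp
  show "continuous_on {0<..} (deriv (dual_fun U))"
    by (rule continuous_on_eq[OF D(2)]) (simp add: eq)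
  \<comment> \<open>The tangent inequality of the convex dual function; the sign, the monotonicity
    and the decay of the derivative are all read off from it.\<close>
  have tan: "deriv (dual_fun U) y * (z - y) \<le> dual_fun U z - dual_fun U y" if "0 < y" "0 < z" for y z
    by (rule convex_on_imp_above_tangent[OF dual_fun_convex[OF U]])
      (use that der[of y] in \<open>auto simp: interior_open intro: has_field_derivative_at_within\<close>)
  show nonpos: "deriv (dual_fun U) y \<le> 0" if "0 < y" for y
    using tan[of y "y + 1"] dual_fun_antimono[OF U, of y "y + 1"] that by simp
  show "deriv (dual_fun U) y \<le> deriv (dual_fun U) z" if "0 < y" "y \<le> z" for y z
  proof (cases "y = z")
    case False
    have "deriv (dual_fun U) y * (z - y) \<le> deriv (dual_fun U) z * (z - y)"
      using tan[of y z] tan[of z y] that by (simp add: algebra_simps)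
    then show ?thesis using False that by (auto dest: mult_right_le_imp_le)
  qed simp
  \<comment> \<open>The tangent at y is compared with the value at y / 2, which lies in the region
    from 1 / 2 on, where the decreasing function V is at most V(1 / 2). Dropping V(y) uses V \<ge>
    0.\<close>
  show "- (2 * dual_fun U (1 / 2) / y) \<le> deriv (dual_fun U) y" if "1 \<le> y" for y
  proof -
    have "deriv (dual_fun U) y * (y / 2 - y) \<le> dual_fun U (y / 2) - dual_fun U y"
      using that by (intro tan) auto
    also have "\<dots> \<le> dual_fun U (1 / 2)"
      using dual_fun_antimono[OF U, of "1 / 2" "y / 2"] dual_fun_nonneg[OF U, of y] that by simp
    finally show ?thesis using that by (simp add: field_simps)
  qed
qed

lemma marginal_dual_fun:
  assumes U: "is_utility U" and C1: "dual_fun U C1_differentiable_on {0<..}"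
    and lim: "((\<lambda>y. deriv (dual_fun U) y / y powr (q - 1)) \<longlongrightarrow> -1) (at_right 0)"
  shows "marginal (\<lambda>s. \<bar>deriv (dual_fun U) (exp s)\<bar>) q"
  unfolding marginal_def
proof (intro conjI allI)
  note * = dual_fun_deriv[OF U C1]
  show "continuous_on UNIV (\<lambda>s. \<bar>deriv (dual_fun U) (exp s)\<bar>)"
    by (intro continuous_intros continuous_on_compose2[OF *(2)]) auto
  show "antimono (\<lambda>s. \<bar>deriv (dual_fun U) (exp s)\<bar>)"
    using *(3,4) by (intro antimonoI) (simp add: abs_of_nonpos)
  have "((\<lambda>s. - (deriv (dual_fun U) (exp s) / exp s powr (q - 1))) \<longlongrightarrow> - (- 1)) at_bot"
    by (intro tendsto_minus filterlim_compose[OF lim])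
      (auto simp: filterlim_at exp_at_bot intro: exp_at_bot)
  then show "((\<lambda>s. \<bar>deriv (dual_fun U) (exp s)\<bar> / exp ((q - 1) * s)) \<longlongrightarrow> 1) at_bot"
    using *(3) by (simp add: powr_def abs_of_nonpos mult.commute)
  show "\<exists>K. \<forall>s\<ge>0. \<bar>deriv (dual_fun U) (exp s)\<bar> \<le> K * exp (- s)"
  proof (intro exI allI impI)
    fix s :: real assume "0 \<le> s"
    then have "- (2 * dual_fun U (1 / 2) / exp s) \<le> deriv (dual_fun U) (exp s)"
      by (intro *(5)) simp
    moreover have "2 * dual_fun U (1 / 2) / exp s = 2 * dual_fun U (1 / 2) * exp (- s)"
      by (simp only: exp_minus divide_inverse)
    moreover have "\<bar>deriv (dual_fun U) (exp s)\<bar> = - deriv (dual_fun U) (exp s)"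
      by (rule abs_of_nonpos) (rule *(3), simp)
    ultimately show "\<bar>deriv (dual_fun U) (exp s)\<bar> \<le> 2 * dual_fun U (1 / 2) * exp (- s)"
      by linarith
  qed
qed auto

text \<open>Far to the left the limit gives the relative error \<epsilon>. On the rest of the line a
  multiple of exp ((m - 1) * s) dominates both functions: \<phi> by monotonicity up to 0 and by its
  decay exp (- s) afterwards, the latter needing m \<ge> 0.\<close>

lemma marginal_approx:
  assumes \<phi>: "marginal \<phi> q" and m: "q < m" "m < 1" "0 \<le> m" and \<epsilon>: "0 < \<epsilon>"
  shows "\<exists>C\<ge>0. \<forall>s. \<bar>\<phi> s - exp ((q - 1) * s)\<bar> \<le> \<epsilon> * exp ((q - 1) * s) + C * exp ((m - 1) * s)"
proof -
  have nn: "0 \<le> \<phi> s" for s using \<phi> by (simp add: marginal_def)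
  obtain K where K: "\<And>s. 0 \<le> s \<Longrightarrow> \<phi> s \<le> K * exp (- s)" using \<phi> by (auto simp: marginal_def)
  have "\<forall>\<^sub>F s in at_bot. dist (\<phi> s / exp ((q - 1) * s)) 1 < \<epsilon>"
    using \<phi> \<epsilon> by (intro tendstoD) (auto simp: marginal_def)
  then obtain S0 where S0: "\<And>s. s \<le> S0 \<Longrightarrow> \<bar>\<phi> s / exp ((q - 1) * s) - 1\<bar> < \<epsilon>"
    by (auto simp: eventually_at_bot_linorder dist_real_def)
  \<comment> \<open>The three summands of \<open>C\<close> bound \<phi> between \<open>S\<close> and
    0, \<phi> on the positive half-line, and exp ((q - 1) * s) to the right of \<open>S\<close>. On
    the first of these ranges exp ((m - 1) * s) is at least 1, as m < 1.\<close>
  define S where "S = min S0 0"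
  define C where "C = \<phi> S + \<bar>K\<bar> + exp ((q - m) * S)"
  have "\<bar>\<phi> s - exp ((q - 1) * s)\<bar> \<le> \<epsilon> * exp ((q - 1) * s) + C * exp ((m - 1) * s)" for s
  proof (cases "s \<le> S")
    case True
    then have "\<bar>\<phi> s / exp ((q - 1) * s) - 1\<bar> \<le> \<epsilon>" using S0[of s] by (simp add: S_def)
    then have "\<bar>\<phi> s / exp ((q - 1) * s) - 1\<bar> * exp ((q - 1) * s) \<le> \<epsilon> * exp ((q - 1) * s)"
      by (intro mult_right_mono) auto
    also have "\<bar>\<phi> s / exp ((q - 1) * s) - 1\<bar> * exp ((q - 1) * s)
        = \<bar>(\<phi> s / exp ((q - 1) * s) - 1) * exp ((q - 1) * s)\<bar>" by (simp add: abs_mult)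
    also have "(\<phi> s / exp ((q - 1) * s) - 1) * exp ((q - 1) * s) = \<phi> s - exp ((q - 1) * s)"
      by (simp add: field_simps)
    moreover have "0 \<le> C * exp ((m - 1) * s)" using nn[of S] by (simp add: C_def)
    ultimately show ?thesis by linarith
  next
    case False
    have "\<phi> s \<le> (\<phi> S + \<bar>K\<bar>) * exp ((m - 1) * s)"
    proof (cases "0 \<le> s")
      case True
      have "\<phi> s \<le> K * exp (- s)" using K True by simp
      also have "\<dots> \<le> (\<phi> S + \<bar>K\<bar>) * exp ((m - 1) * s)"
        using nn[of S] m True by (intro mult_mono) (auto simp: algebra_simps)
      finally show ?thesis .
    next
      case s: False
      have "\<phi> s \<le> \<phi> S" using \<phi> False by (auto simp: marginal_def antimono_def)
      also have "\<dots> \<le> (\<phi> S + \<bar>K\<bar>) * exp ((m - 1) * s)"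
      proof -
        have "1 \<le> exp ((m - 1) * s)" using s m by (simp add: mult_nonpos_nonpos)
        then have "(\<phi> S + \<bar>K\<bar>) * 1 \<le> (\<phi> S + \<bar>K\<bar>) * exp ((m - 1) * s)"
          using nn[of S] by (intro mult_left_mono) auto
        then show ?thesis by simp
      qed
      finally show ?thesis .
    qed
    moreover have "exp ((q - 1) * s) \<le> exp ((q - m) * S) * exp ((m - 1) * s)"
    proof -
      have "(q - m) * s \<le> (q - m) * S" using False m by (intro mult_left_mono_neg) auto
      then show ?thesis by (simp add: exp_add[symmetric] algebra_simps)
    qed
    moreover have "0 \<le> \<epsilon> * exp ((q - 1) * s)" using \<epsilon> by simp
    moreover have "C * exp ((m - 1) * s) = (\<phi> S + \<bar>K\<bar>) * exp ((m - 1) * s) + exp ((q - m) * S) * exp ((m - 1) * s)"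
      by (simp add: C_def algebra_simps)
    ultimately show ?thesis using nn[of s] exp_gt_zero[of "(q - 1) * s"] by linarith
  qed
  moreover have "0 \<le> C" using nn[of S] by (simp add: C_def)
  ultimately show ?thesis by blast
qed

lemma marginal_bound:
  assumes \<phi>: "marginal \<phi> q" and m: "q < m" "m < 1" "0 \<le> m"
  shows "\<exists>C\<ge>0. \<forall>s. \<bar>\<phi> s\<bar> \<le> 2 * exp ((q - 1) * s) + C * exp ((m - 1) * s)"
proof -
  obtain C where "0 \<le> C" and C: "\<And>s. \<bar>\<phi> s - exp ((q - 1) * s)\<bar> \<le> 1 * exp ((q - 1) * s) + C * exp ((m - 1) * s)"
    using marginal_approx[OF assms, of 1] by auto
  moreover have "\<bar>\<phi> s\<bar> \<le> 2 * exp ((q - 1) * s) + C * exp ((m - 1) * s)" for s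
    using C[of s] exp_gt_zero[of "(q - 1) * s"] by linarith
  ultimately show ?thesis by blast
qed

lemma marginal_exp_growth:
  assumes \<phi>: "marginal \<phi> q" and q: "q < 1"
  shows "exp_growth \<phi>"
proof -
  \<comment> \<open>Some exponent strictly between q and 1 that is also nonnegative, as
    \<open>marginal_bound\<close> demands.\<close>
  define m where "m = max ((q + 1) / 2) 0"
  have m: "q < m" "m < 1" "0 \<le> m" using q by (auto simp: m_def less_max_iff_disj)
  obtain C where "0 \<le> C" and C: "\<And>s. \<bar>\<phi> s\<bar> \<le> 2 * exp ((q - 1) * s) + C * exp ((m - 1) * s)"
    using marginal_bound[OF \<phi> m] by auto
  have "\<bar>\<phi> s\<bar> \<le> (2 + C) * exp ((1 - q) * \<bar>s\<bar>)" for s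
  proof -
    have *: "exp ((p - 1) * s) \<le> exp ((1 - q) * \<bar>s\<bar>)" if "q \<le> p" "p \<le> 1" for p
    proof -
      have "(p - 1) * s \<le> \<bar>p - 1\<bar> * \<bar>s\<bar>" by (metis abs_ge_self abs_mult)
      also have "\<dots> \<le> (1 - q) * \<bar>s\<bar>" using that by (intro mult_right_mono) auto
      finally show ?thesis by simp
    qed
    have "2 * exp ((q - 1) * s) + C * exp ((m - 1) * s) \<le> 2 * exp ((1 - q) * \<bar>s\<bar>) + C * exp ((1 - q) * \<bar>s\<bar>)"
      using m q \<open>0 \<le> C\<close> by (intro add_mono mult_left_mono *) auto
    then show ?thesis using C[of s] by (simp add: algebra_simps)
  qed
  then show ?thesis using \<phi> by (auto simp: exp_growth_def marginal_def)
qed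

section \<open>The flow of a marginal function\<close>

text \<open>The flow is linear and known exactly on exponentials, so \<open>flow_bounds\<close> is
  applied to the difference of \<phi> and its leading exponential, estimated by
  \<open>marginal_approx\<close>.\<close>

lemma asymp_power_flow:
  assumes \<phi>: "marginal \<phi> q" and m: "q < m" "m < 1" "0 \<le> m" and a: "a \<noteq> 0"
  shows "asymp_power (growth_rate \<alpha> a \<beta>) (flow \<alpha> a \<beta> \<phi>) 1 q m"
    and "asymp_power (growth_rate \<alpha> a \<beta>) (flow_deriv \<alpha> a \<beta> \<phi>) (q - 1) q m"
proof -
  let ?e = "\<lambda>s. exp ((q - 1) * s)" and ?lam = "growth_rate \<alpha> a \<beta>"
  have gr: "exp_growth \<phi>" using marginal_exp_growth[OF \<phi>] m by simp
  have gd: "exp_growth (\<lambda>s. \<phi> s - ?e s)" by (intro exp_growth_diff gr exp_growth_exp)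
  have flow_diff: "flow \<alpha> a \<beta> (\<lambda>s. \<phi> s - ?e s) u t = flow \<alpha> a \<beta> \<phi> u t - 1 * exp ((q - 1) * u + ?lam q * t)"
    if "0 < t" for u t
    using that flow_exp[of t \<alpha> a \<beta> q u] by (simp add: flow_def gauss_avg_diff[OF gr exp_growth_exp] right_diff_distrib)
  have flow_deriv_diff: "flow_deriv \<alpha> a \<beta> (\<lambda>s. \<phi> s - ?e s) u t
      = flow_deriv \<alpha> a \<beta> \<phi> u t - (q - 1) * exp ((q - 1) * u + ?lam q * t)" if "0 < t" for u t
    using that flow_deriv_exp[of a t \<alpha> \<beta> q u] a
    by (simp add: flow_deriv_def gauss_avg_diff[OF gr exp_growth_exp] right_diff_distrib)
  obtain K where K: "0 \<le> K" "\<And>h \<epsilon> C u t. exp_growth h \<Longrightarrow> 0 \<le> \<epsilon> \<Longrightarrow> 0 \<le> C \<Longrightarrow> 0 < t \<Longrightarrow>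
      (\<And>s. \<bar>h s\<bar> \<le> \<epsilon> * exp ((q - 1) * s) + C * exp ((m - 1) * s)) \<Longrightarrow>
      max \<bar>flow \<alpha> a \<beta> h u t\<bar> \<bar>flow_deriv \<alpha> a \<beta> h u t\<bar> \<le> K * (1 + 1 / sqrt t) *
        (\<epsilon> * exp ((q - 1) * u + ?lam q * t) + C * exp ((m - 1) * u + ?lam m * t))"
    using flow_bounds[OF a, of q m \<alpha> \<beta>] by metis
  have main: "\<exists>C\<ge>0. \<forall>u. \<forall>t>0.
     max \<bar>flow \<alpha> a \<beta> \<phi> u t - 1 * exp ((q - 1) * u + ?lam q * t)\<bar>
       \<bar>flow_deriv \<alpha> a \<beta> \<phi> u t - (q - 1) * exp ((q - 1) * u + ?lam q * t)\<bar>
     \<le> (1 + 1 / sqrt t) * (\<epsilon> * exp ((q - 1) * u + ?lam q * t) + C * exp ((m - 1) * u + ?lam m * t))"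
    if \<epsilon>: "0 < \<epsilon>" for \<epsilon>
  proof -
    \<comment> \<open>The factor \<open>K\<close> does not depend on the function averaged, so the
      error asked of \<phi> can be shrunk beforehand to compensate for it.\<close>
    have "0 < \<epsilon> / (K + 1)" using \<epsilon> K(1) by simp
    then obtain C where C: "0 \<le> C"
      "\<And>s. \<bar>\<phi> s - ?e s\<bar> \<le> \<epsilon> / (K + 1) * ?e s + C * exp ((m - 1) * s)"
      using marginal_approx[OF \<phi> m] by blast
    have "max \<bar>flow \<alpha> a \<beta> \<phi> u t - 1 * exp ((q - 1) * u + ?lam q * t)\<bar>
       \<bar>flow_deriv \<alpha> a \<beta> \<phi> u t - (q - 1) * exp ((q - 1) * u + ?lam q * t)\<bar>
     \<le> (1 + 1 / sqrt t) * (\<epsilon> * exp ((q - 1) * u + ?lam q * t) + (K * C) * exp ((m - 1) * u + ?lam m * t))"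
      if t: "0 < t" for u t
    proof -
      have "max \<bar>flow \<alpha> a \<beta> \<phi> u t - 1 * exp ((q - 1) * u + ?lam q * t)\<bar>
           \<bar>flow_deriv \<alpha> a \<beta> \<phi> u t - (q - 1) * exp ((q - 1) * u + ?lam q * t)\<bar>
        \<le> K * (1 + 1 / sqrt t) * (\<epsilon> / (K + 1) * exp ((q - 1) * u + ?lam q * t) + C * exp ((m - 1) * u + ?lam m * t))"
        unfolding flow_diff[OF t, symmetric] flow_deriv_diff[OF t, symmetric]
        using \<open>0 < \<epsilon> / (K + 1)\<close> by (intro K(2) gd C t) simp
      also have "\<dots> = (1 + 1 / sqrt t) * ((K * (\<epsilon> / (K + 1))) * exp ((q - 1) * u + ?lam q * t)
          + (K * C) * exp ((m - 1) * u + ?lam m * t))"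
        by (simp only: distrib_left distrib_right mult_ac)
      also have "\<dots> \<le> (1 + 1 / sqrt t) * (\<epsilon> * exp ((q - 1) * u + ?lam q * t)
          + (K * C) * exp ((m - 1) * u + ?lam m * t))"
      proof -
        have "K * (\<epsilon> / (K + 1)) \<le> \<epsilon>" using K(1) \<epsilon> by (simp add: divide_le_eq algebra_simps)
        then show ?thesis using t by (intro mult_left_mono add_right_mono mult_right_mono) auto
      qed
      finally show ?thesis .
    qed
    moreover have "0 \<le> K * C" using K C by simp
    ultimately show ?thesis by blast
  qed
  show "asymp_power ?lam (flow \<alpha> a \<beta> \<phi>) 1 q m"
    and "asymp_power ?lam (flow_deriv \<alpha> a \<beta> \<phi>) (q - 1) q m"
    unfolding asymp_power_def using main by (meson max.boundedE)+
qed

text \<open>A majorant integrable in \<tau> and common to all u in a bounded interval: what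
  differentiation under the horizon integral requires.\<close>

lemma flow_dominated:
  assumes \<phi>: "marginal \<phi> q" and q: "q < 1" and a: "a \<noteq> 0"
  shows "\<exists>w. set_integrable lborel {0<..t} w \<and> (\<forall>u \<tau>. \<bar>u\<bar> \<le> r \<longrightarrow> 0 < \<tau> \<longrightarrow>
     \<bar>flow \<alpha> a \<beta> \<phi> u \<tau>\<bar> \<le> w \<tau> \<and> \<bar>flow_deriv \<alpha> a \<beta> \<phi> u \<tau>\<bar> \<le> w \<tau>)"
proof -
  let ?lam = "growth_rate \<alpha> a \<beta>"
  define m where "m = max ((q + 1) / 2) 0"
  have m: "q < m" "m < 1" "0 \<le> m" using q by (auto simp: m_def less_max_iff_disj)
  obtain C where C: "0 \<le> C" "\<And>s. \<bar>\<phi> s\<bar> \<le> 2 * exp ((q - 1) * s) + C * exp ((m - 1) * s)"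
    using marginal_bound[OF \<phi> m] by auto
  obtain K where K: "0 \<le> K" "\<And>h \<epsilon> C u t. exp_growth h \<Longrightarrow> 0 \<le> \<epsilon> \<Longrightarrow> 0 \<le> C \<Longrightarrow> 0 < t \<Longrightarrow>
      (\<And>s. \<bar>h s\<bar> \<le> \<epsilon> * exp ((q - 1) * s) + C * exp ((m - 1) * s)) \<Longrightarrow>
      max \<bar>flow \<alpha> a \<beta> h u t\<bar> \<bar>flow_deriv \<alpha> a \<beta> h u t\<bar> \<le> K * (1 + 1 / sqrt t) *
        (\<epsilon> * exp ((q - 1) * u + ?lam q * t) + C * exp ((m - 1) * u + ?lam m * t))"
    using flow_bounds[OF a, of q m \<alpha> \<beta>] by metis
  define w where "w \<tau> = (K * 2 * exp ((1 - q) * r)) * ((1 + 1 / sqrt \<tau>) * exp (?lam q * \<tau>))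
     + (K * C * exp ((1 - m) * r)) * ((1 + 1 / sqrt \<tau>) * exp (?lam m * \<tau>))" for \<tau>
  have "set_integrable lborel {0<..t} w"
    unfolding w_def[abs_def] by (intro set_integral_add(1) set_integrable_mult_right set_integrable_weight)
  moreover have "max \<bar>flow \<alpha> a \<beta> \<phi> u \<tau>\<bar> \<bar>flow_deriv \<alpha> a \<beta> \<phi> u \<tau>\<bar> \<le> w \<tau>"
    if u: "\<bar>u\<bar> \<le> r" and \<tau>: "0 < \<tau>" for u \<tau>
  proof -
    have *: "exp ((p - 1) * u) \<le> exp ((1 - p) * r)" if "p < 1" for p
    proof -
      have "(1 - p) * (- u) \<le> (1 - p) * r" using u that by (intro mult_left_mono) auto
      then show ?thesis by (simp add: algebra_simps)
    qed
    have "max \<bar>flow \<alpha> a \<beta> \<phi> u \<tau>\<bar> \<bar>flow_deriv \<alpha> a \<beta> \<phi> u \<tau>\<bar> \<le> K * (1 + 1 / sqrt \<tau>) *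
        (2 * exp ((q - 1) * u + ?lam q * \<tau>) + C * exp ((m - 1) * u + ?lam m * \<tau>))"
      by (intro K(2) marginal_exp_growth[OF \<phi> q] C \<tau>) simp
    also have "\<dots> \<le> K * (1 + 1 / sqrt \<tau>) *
        (2 * (exp ((1 - q) * r) * exp (?lam q * \<tau>)) + C * (exp ((1 - m) * r) * exp (?lam m * \<tau>)))"
      unfolding exp_add using K(1) \<tau> C(1) q m
      by (intro mult_left_mono add_mono mult_right_mono *) auto
    also have "\<dots> = w \<tau>" unfolding w_def by (simp add: algebra_simps)
    finally show ?thesis .
  qed
  ultimately show ?thesis by (intro exI[of _ w]) auto
qed

lemma set_integrable_flow:
  assumes \<phi>: "marginal \<phi> q" and q: "q < 1" and a: "a \<noteq> 0"
  shows "set_integrable lborel {0<..t} (flow \<alpha> a \<beta> \<phi> u)"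
    and "set_integrable lborel {0<..t} (flow_deriv \<alpha> a \<beta> \<phi> u)"
proof -
  obtain w where w: "set_integrable lborel {0<..t} w" "\<And>\<tau>. 0 < \<tau> \<Longrightarrow>
     \<bar>flow \<alpha> a \<beta> \<phi> u \<tau>\<bar> \<le> w \<tau> \<and> \<bar>flow_deriv \<alpha> a \<beta> \<phi> u \<tau>\<bar> \<le> w \<tau>"
    using flow_dominated[OF assms, of t "\<bar>u\<bar>" \<alpha> \<beta>] by blast
  note [measurable] = measurable_flow[OF marginal_exp_growth[OF \<phi> q]]
  show "set_integrable lborel {0<..t} (flow \<alpha> a \<beta> \<phi> u)"
    by (rule set_integrable_bound[OF w(1)])
      (use w(2) in \<open>auto simp: set_borel_measurable_def intro!: AE_I2 order_trans[OF _ abs_ge_self]\<close>)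
  show "set_integrable lborel {0<..t} (flow_deriv \<alpha> a \<beta> \<phi> u)"
    by (rule set_integrable_bound[OF w(1)])
      (use w(2) in \<open>auto simp: set_borel_measurable_def intro!: AE_I2 order_trans[OF _ abs_ge_self]\<close>)
qed

lemma has_real_derivative_integral_flow:
  assumes \<phi>: "marginal \<phi> q" and q: "q < 1" and a: "a \<noteq> 0"
  shows "((\<lambda>u. LBINT \<tau>:{0<..t}. flow \<alpha> a \<beta> \<phi> u \<tau>) has_real_derivative
     (LBINT \<tau>:{0<..t}. flow_deriv \<alpha> a \<beta> \<phi> u \<tau>)) (at u)"
proof -
  note gr = marginal_exp_growth[OF \<phi> q]
  note [measurable] = measurable_flow[OF gr]
  obtain w where w: "set_integrable lborel {0<..t} w" "\<And>y \<tau>. \<bar>y\<bar> \<le> \<bar>u\<bar> + 1 \<Longrightarrow> 0 < \<tau> \<Longrightarrow>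
     \<bar>flow \<alpha> a \<beta> \<phi> y \<tau>\<bar> \<le> w \<tau> \<and> \<bar>flow_deriv \<alpha> a \<beta> \<phi> y \<tau>\<bar> \<le> w \<tau>"
    using flow_dominated[OF assms, of t "\<bar>u\<bar> + 1" \<alpha> \<beta>] by blast
  show ?thesis
    unfolding set_lebesgue_integral_def
  proof (rule has_real_derivative_integral[where e = 1 and w = "\<lambda>\<tau>. indicator {0<..t} \<tau> *\<^sub>R w \<tau>"])
    show "integrable lborel (\<lambda>\<tau>. indicator {0<..t} \<tau> *\<^sub>R flow \<alpha> a \<beta> \<phi> y \<tau>)" for y
      using set_integrable_flow(1)[OF assms] by (simp add: set_integrable_def)
    show "integrable lborel (\<lambda>\<tau>. indicator {0<..t} \<tau> *\<^sub>R w \<tau>)"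
      using w(1) by (simp add: set_integrable_def)
    show "AE \<tau> in lborel. \<forall>y. \<bar>y - u\<bar> < 1 \<longrightarrow>
       ((\<lambda>y. indicator {0<..t} \<tau> *\<^sub>R flow \<alpha> a \<beta> \<phi> y \<tau>) has_real_derivative
         indicator {0<..t} \<tau> *\<^sub>R flow_deriv \<alpha> a \<beta> \<phi> y \<tau>) (at y)"
      using has_real_derivative_flow[OF gr a] by (intro AE_I2) (auto simp: indicator_def)
    show "AE \<tau> in lborel. \<forall>y. \<bar>y - u\<bar> < 1 \<longrightarrow>
       \<bar>indicator {0<..t} \<tau> *\<^sub>R flow_deriv \<alpha> a \<beta> \<phi> y \<tau>\<bar> \<le> indicator {0<..t} \<tau> *\<^sub>R w \<tau>"
    proof (intro AE_I2 allI impI)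
      fix \<tau> y assume "\<bar>y - u\<bar> < 1"
      then have "\<bar>y\<bar> \<le> \<bar>u\<bar> + 1" by linarith
      then show "\<bar>indicator {0<..t} \<tau> *\<^sub>R flow_deriv \<alpha> a \<beta> \<phi> y \<tau>\<bar> \<le> indicator {0<..t} \<tau> *\<^sub>R w \<tau>"
        using w(2)[of y \<tau>] by (auto simp: indicator_def)
    qed
  qed auto
qed

lemma flow_antimono:
  assumes \<phi>: "marginal \<phi> q" and q: "q < 1" and uv: "u \<le> v"
  shows "flow \<alpha> a \<beta> \<phi> v t \<le> flow \<alpha> a \<beta> \<phi> u t"
proof -
  note gr = marginal_exp_growth[OF \<phi> q]
  let ?b = "a * sqrt t"
  have "\<phi> (v + ?b * \<eta>) \<le> \<phi> (u + ?b * \<eta>)" for \<eta>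
    using \<phi> uv by (auto simp: marginal_def antimono_def)
  then have "(LBINT \<eta>. (1 + 0 * \<eta>) * exp (- \<eta>\<^sup>2 / 4 - (\<alpha> - 1) * ?b * \<eta>) * \<phi> (v + ?b * \<eta>))
      \<le> (LBINT \<eta>. (1 + 0 * \<eta>) * exp (- \<eta>\<^sup>2 / 4 - (\<alpha> - 1) * ?b * \<eta>) * \<phi> (u + ?b * \<eta>))"
    by (intro integral_mono integrable_affine_gauss gr) (auto intro: mult_left_mono)
  then show ?thesis
    unfolding flow_def gauss_avg_def by (intro mult_left_mono divide_right_mono) auto
qed

text \<open>A periodic \<open>\<phi>\<close> could not behave like \<open>exp ((q - 1) * s)\<close> as \<open>s \<rightarrow> - \<infinity>\<close>.\<close>

lemma marginal_not_periodic:
  assumes \<phi>: "marginal \<phi> q" and q: "q < 1" and d: "0 < d"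
  shows "\<exists>s. \<phi> (s + d) \<noteq> \<phi> s"
proof (rule ccontr)
  assume "\<not> ?thesis"
  then have per: "\<phi> (s + d) = \<phi> s" for s by simp
  have it: "\<phi> (- (real n * d)) = \<phi> 0" for n
  proof (induction n)
    case (Suc n)
    have "\<phi> (- (real (Suc n) * d)) = \<phi> (- (real (Suc n) * d) + d)" by (simp only: per)
    also have "- (real (Suc n) * d) + d = - (real n * d)" by (simp add: algebra_simps)
    finally show ?case using Suc by simp
  qed simp
  have lim: "filterlim (\<lambda>n. - (real n * d)) at_bot sequentially"
    using filterlim_tendsto_pos_mult_at_top[OF tendsto_const d filterlim_real_sequentially]
    by (simp add: filterlim_uminus_at_bot mult.commute)
  have "((\<lambda>s. \<phi> s / exp ((q - 1) * s)) \<longlongrightarrow> 1) at_bot" using \<phi> by (simp add: marginal_def)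
  from filterlim_compose[OF this lim]
  have "(\<lambda>n. \<phi> 0 / exp ((q - 1) * - (real n * d))) \<longlonglongrightarrow> 1" by (simp only: it)
  moreover have "(\<lambda>n. \<phi> 0 / exp ((q - 1) * - (real n * d))) \<longlonglongrightarrow> 0"
  proof (intro tendsto_divide_0[OF tendsto_const] filterlim_at_top_imp_at_infinity
      filterlim_compose[OF exp_at_top])
    have "filterlim (\<lambda>n. (1 - q) * d * real n) at_top sequentially"
      using q d by (intro filterlim_tendsto_pos_mult_at_top[OF tendsto_const _ filterlim_real_sequentially]) simp
    then show "filterlim (\<lambda>n. (q - 1) * - (real n * d)) at_top sequentially"
      by (simp add: algebra_simps)
  qed
  ultimately show False using LIMSEQ_unique by force
qed

text \<open>Since \<phi> is only weakly decreasing, strictness comes from averaging over the whole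
  line. If equality held, the nonnegative continuous integrand \<open>D\<close> would vanish almost
  everywhere, hence everywhere, because a nonempty open set is not negligible; then \<phi> would
  have period v - u.\<close>

lemma flow_strict_antimono:
  assumes \<phi>: "marginal \<phi> q" and q: "q < 1" and a: "a \<noteq> 0" and t: "0 < t" and uv: "u < v"
  shows "flow \<alpha> a \<beta> \<phi> v t < flow \<alpha> a \<beta> \<phi> u t"
proof -
  note gr = marginal_exp_growth[OF \<phi> q]
  note [measurable] = exp_growth_measurable[OF gr]
  define b where "b = a * sqrt t"
  have b: "b \<noteq> 0" using a t by (simp add: b_def)
  have cont: "continuous_on UNIV \<phi>" and anti: "antimono \<phi>" using \<phi> by (auto simp: marginal_def)
  define k where "k \<eta> = exp (- \<eta>\<^sup>2 / 4 - (\<alpha> - 1) * b * \<eta>)" for \<eta>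
  define D where "D \<eta> = k \<eta> * (\<phi> (u + b * \<eta>) - \<phi> (v + b * \<eta>))" for \<eta>
  have kpos: "0 < k \<eta>" for \<eta> by (simp add: k_def)
  have int: "integrable lborel (\<lambda>\<eta>. k \<eta> * \<phi> (w + b * \<eta>))" for w
    using integrable_affine_gauss[OF gr, of 1 0 "(\<alpha> - 1) * b" w b] by (simp add: k_def)
  then have intD: "integrable lborel D" unfolding D_def right_diff_distrib by simp
  have nn: "0 \<le> D \<eta>" for \<eta>
    using anti uv kpos[of \<eta>] by (auto simp: D_def antimono_def intro!: mult_nonneg_nonneg)
  have "(LBINT \<eta>. D \<eta>) \<noteq> 0"
  proof
    assume "(LBINT \<eta>. D \<eta>) = 0"
    then have "AE \<eta> in lborel. D \<eta> = 0"
      using integral_nonneg_eq_0_iff_AE[OF intD] nn by auto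
    then have ae: "AE \<eta> in lebesgue. \<eta> \<notin> {\<eta>. D \<eta> \<noteq> 0}"
      by (auto intro: AE_completion)
    have "continuous_on UNIV D"
      unfolding D_def k_def by (intro continuous_intros continuous_on_compose2[OF cont]) auto
    then have "open {\<eta>. D \<eta> \<noteq> 0}"
      by (intro open_Collect_neq continuous_intros)
    moreover have "negligible {\<eta>. D \<eta> \<noteq> 0}"
      using ae by (simp add: negligible_iff_null_sets AE_iff_null_sets open_Collect_neq[OF \<open>continuous_on UNIV D\<close>] borel_open lmeasurable_open)
    ultimately have "{\<eta>. D \<eta> \<noteq> 0} = {}" using open_not_negligible by blast
    then have D0: "\<phi> (u + b * \<eta>) = \<phi> (v + b * \<eta>)" for \<eta>
    proof -
      have "D \<eta> = 0" using \<open>{\<eta>. D \<eta> \<noteq> 0} = {}\<close> by auto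
      then show ?thesis using kpos[of \<eta>] by (simp add: D_def)
    qed
    have "\<phi> (s + (v - u)) = \<phi> s" for s
    proof -
      have "b * ((s - u) / b) = s - u" using b by simp
      then have "u + b * ((s - u) / b) = s" "v + b * ((s - u) / b) = s + (v - u)" by simp_all
      then show ?thesis using D0[of "(s - u) / b"] by (simp only:)
    qed
    then show False using marginal_not_periodic[OF \<phi> q, of "v - u"] uv by auto
  qed
  moreover have "0 \<le> (LBINT \<eta>. D \<eta>)" using nn by simp
  ultimately have "0 < (LBINT \<eta>. D \<eta>)" by simp
  also have "(LBINT \<eta>. D \<eta>) = (LBINT \<eta>. k \<eta> * \<phi> (u + b * \<eta>)) - (LBINT \<eta>. k \<eta> * \<phi> (v + b * \<eta>))"
    using int by (simp add: D_def right_diff_distrib)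
  finally show ?thesis
    by (simp add: flow_def gauss_avg_def b_def k_def divide_strict_right_mono)
qed

section \<open>Dominant exponents\<close>

lemma exp_avg_ge:
  assumes "0 \<le> l" "0 \<le> t"
  shows "t \<le> exp_avg l t"
proof (cases "l = 0")
  case False
  then have "l * t \<le> exp (l * t) - 1"
    using exp_ge_add_one_self[of "l * t"] by linarith
  then show ?thesis using False assms by (simp add: exp_avg_def field_simps)
qed (simp add: exp_avg_def)

lemma exp_avg_le:
  assumes "0 \<le> l" "0 \<le> t"
  shows "exp_avg l t \<le> t * exp (l * t)"
proof (cases "l = 0")
  case False
  have "1 - l * t \<le> exp (- (l * t))"
    using exp_ge_add_one_self[of "- (l * t)"] by linarith
  then have "(1 - l * t) * exp (l * t) \<le> exp (- (l * t)) * exp (l * t)"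
    by (intro mult_right_mono) auto
  also have "\<dots> = 1" by (simp add: exp_add[symmetric])
  finally show ?thesis using False assms by (simp add: exp_avg_def field_simps)
qed (simp add: exp_avg_def)

lemma exp_avg_nonneg: "0 \<le> t \<Longrightarrow> 0 \<le> exp_avg l t"
  by (subst set_integral_exp(2)[symmetric]) (auto simp: set_lebesgue_integral_def)

lemma exp_avg_ge_exp:
  assumes "0 \<le> l"
  shows "\<exists>c>0. \<forall>t\<ge>1. c * exp (l * t) \<le> exp_avg l t"
proof (cases "l = 0")
  case True
  then show ?thesis by (intro exI[of _ 1]) (auto simp: exp_avg_def)
next
  case False
  with assms have l: "0 < l" by simp
  show ?thesis
  \<comment> \<open>The witness is the quotient of \<open>exp_avg l t\<close> by exp (l * t) at t =
    1; this quotient increases in t.\<close>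
  proof (intro exI[of _ "(1 - exp (- l)) / l"] conjI allI impI)
    show "0 < (1 - exp (- l)) / l" using l by simp
    fix t :: real assume "1 \<le> t"
    then have "0 \<le> l * (t - 1)" using l by simp
    then have "1 \<le> exp (l * (t - 1))" by simp
    also have "\<dots> = exp (- l) * exp (l * t)" by (simp add: exp_add[symmetric] algebra_simps)
    finally have "exp (l * t) - exp (- l) * exp (l * t) \<le> exp (l * t) - 1" by simp
    then have "(1 - exp (- l)) * exp (l * t) / l \<le> (exp (l * t) - 1) / l"
      using l by (intro divide_right_mono) (auto simp: algebra_simps)
    then show "(1 - exp (- l)) / l * exp (l * t) \<le> exp_avg l t"
      using l by (simp add: exp_avg_def)
  qed
qed

text \<open>\<open>exp ((m - 1) * u)\<close> is the power \<open>(m - 1) / (q - 1)\<close> of \<open>exp ((q - 1) * u)\<close>, hence comparable to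
  \<open>E\<close> to the power \<open>- (m - 1) / (q - 1)\<close>.\<close>

lemma subdominant_vanishes:
  fixes E F u :: "real \<Rightarrow> real"
  assumes q: "q < m" "m < 1"
    and E: "filterlim E at_top at_top" "0 < c" "\<forall>\<^sub>F t in at_top. c * exp (lq * t) \<le> E t"
    and gap: "0 \<le> lq" "lm * (1 - q) < lq * (1 - m)"
    and u: "((\<lambda>t. exp ((q - 1) * u t) * E t) \<longlongrightarrow> k) at_top" "0 < k"
    and F: "F = (\<lambda>t. exp (lm * t)) \<or> F = exp_avg lm"
  shows "((\<lambda>t. exp ((m - 1) * u t) * F t) \<longlongrightarrow> 0) at_top"
proof -
  define \<rho> where "\<rho> = (1 - m) / (1 - q)"
  have \<rho>: "0 < \<rho>" using q by (simp add: \<rho>_def)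
  have Fnn: "\<forall>\<^sub>F t in at_top. 0 \<le> F t"
    using eventually_ge_at_top[of 0] by eventually_elim (use F exp_avg_nonneg in auto)
  have Epos: "\<forall>\<^sub>F t in at_top. 0 < E t" using E(1) by (simp add: filterlim_at_top_dense)
  \<comment> \<open>The sign of \<open>lm\<close> matters. If it is negative,
    \<open>exp_avg lm\<close> stays bounded but does not decay like exp (lm * t), so the growth of
    \<open>E\<close> must do the work; otherwise the gap between the exponential rates does
    it.\<close>
  have F0: "((\<lambda>t. E t powr (- \<rho>) * F t) \<longlongrightarrow> 0) at_top"
  proof (cases "lm < 0")
    case True
    have Fb: "\<forall>\<^sub>F t in at_top. F t \<le> 1 + 1 / - lm"
      using eventually_ge_at_top[of 0]
    proof eventually_elim
      case (elim t)
      have "exp (lm * t) \<le> 1" using True elim by (simp add: mult_nonpos_nonneg)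
      moreover have "0 \<le> 1 / - lm" using True by simp
      moreover have "(exp (lm * t) - 1) / lm \<le> 1 / - lm"
        using True mult_nonpos_nonneg[of lm "exp (lm * t)"] by (simp add: field_simps)
      moreover have "F t = exp (lm * t) \<or> F t = (exp (lm * t) - 1) / lm"
        using F True by (auto simp: exp_avg_def)
      ultimately show ?case by linarith
    qed
    have "((\<lambda>t. E t powr (- \<rho>) * (1 + 1 / - lm)) \<longlongrightarrow> 0) at_top"
      using \<rho> E(1) by (intro tendsto_mult_left_zero tendsto_neg_powr) auto
    then show ?thesis
    proof (rule tendsto_sandwich[OF _ _ tendsto_const, rotated 2])
      show "\<forall>\<^sub>F t in at_top. 0 \<le> E t powr (- \<rho>) * F t"
        using Fnn by eventually_elim auto
      show "\<forall>\<^sub>F t in at_top. E t powr (- \<rho>) * F t \<le> E t powr (- \<rho>) * (1 + 1 / - lm)"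
        using Fb by eventually_elim (auto intro: mult_left_mono)
    qed
  next
    case False
    \<comment> \<open>This is 1 - m times the difference of lq / (1 - q) and lm / (1 - m), positive
      by the gap hypothesis. The factor 1 + t below covers both forms of \<open>F\<close>, including
      \<open>exp_avg lm t\<close> = t at \<open>lm\<close> = 0.\<close>
    define g where "g = \<rho> * lq - lm"
    have g: "0 < g" using gap q by (simp add: g_def \<rho>_def field_simps)
    have "((\<lambda>t. (1 + t) * exp (- (g * t))) \<longlongrightarrow> 0) at_top"
      using g by real_asymp
    then have "((\<lambda>t. c powr (- \<rho>) * ((1 + t) * exp (- (g * t)))) \<longlongrightarrow> 0) at_top"
      by (rule tendsto_mult_right_zero)
    then show ?thesis
    proof (rule tendsto_sandwich[OF _ _ tendsto_const, rotated 2])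
      show "\<forall>\<^sub>F t in at_top. 0 \<le> E t powr (- \<rho>) * F t"
        using Fnn by eventually_elim auto
      show "\<forall>\<^sub>F t in at_top. E t powr (- \<rho>) * F t \<le> c powr (- \<rho>) * ((1 + t) * exp (- (g * t)))"
        using E(3) Fnn eventually_ge_at_top[of 0]
      proof eventually_elim
        case (elim t)
        have "exp_avg lm t \<le> t * exp (lm * t)" using False elim by (intro exp_avg_le) auto
        moreover have "0 \<le> t * exp (lm * t)" using elim by simp
        ultimately have "F t \<le> (1 + t) * exp (lm * t)"
          using F by (auto simp: algebra_simps intro: order_trans)
        moreover have "E t powr (- \<rho>) \<le> (c * exp (lq * t)) powr (- \<rho>)"
          using elim(1) E(2) \<rho> by (intro powr_mono2') auto
        ultimately have "E t powr (- \<rho>) * F t \<le> (c * exp (lq * t)) powr (- \<rho>) * ((1 + t) * exp (lm * t))"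
          using elim by (intro mult_mono) auto
        also have "(c * exp (lq * t)) powr (- \<rho>) = c powr (- \<rho>) * exp (- (\<rho> * lq * t))"
          using E(2) by (simp add: powr_mult) (simp add: powr_def algebra_simps)
        also have "c powr (- \<rho>) * exp (- (\<rho> * lq * t)) * ((1 + t) * exp (lm * t))
            = c powr (- \<rho>) * ((1 + t) * exp (- (g * t)))"
          by (simp add: g_def exp_add[symmetric] algebra_simps)
        finally show ?case .
      qed
    qed
  qed
  have "((\<lambda>t. (exp ((q - 1) * u t) * E t) powr \<rho> * (E t powr (- \<rho>) * F t)) \<longlongrightarrow> k powr \<rho> * 0) at_top"
    using u by (intro tendsto_mult F0 tendsto_powr tendsto_const) auto
  moreover have "\<forall>\<^sub>F t in at_top. (exp ((q - 1) * u t) * E t) powr \<rho> * (E t powr (- \<rho>) * F t) = exp ((m - 1) * u t) * F t"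
    using Epos
  proof eventually_elim
    case (elim t)
    have "(exp ((q - 1) * u t) * E t) powr \<rho> = exp ((m - 1) * u t) * E t powr \<rho>"
      using elim q by (simp add: powr_mult) (simp add: powr_def \<rho>_def field_simps)
    moreover have "E t powr \<rho> * E t powr (- \<rho>) = 1"
      using elim by (simp add: powr_add[symmetric])
    ultimately show ?case by simp
  qed
  ultimately show ?thesis by (auto elim: Lim_transform_eventually)
qed

text \<open>The coefficient of exp ((min q1 q2 - 1) * u) in the leading part of - v_y; both summands
  are present exactly when q1 = q2. It is R(t), except that for q1 < q2 the latter is its power (q2
  - 1) / (q1 - 1).\<close>

definition dominant :: "(real \<Rightarrow> real) \<Rightarrow> real \<Rightarrow> real \<Rightarrow> real \<Rightarrow> real" where
  "dominant lam q1 q2 t = (if q1 \<le> q2 then exp (lam q1 * t) else 0) + (if q2 \<le> q1 then exp_avg (lam q2) t else 0)"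

text \<open>At rate 0 the integrated term is t and still grows, whereas the exponential is
  constantly 1. So a strictly positive rate is asked for only when the exponential stands
  alone.\<close>

lemma dominant_at_top:
  assumes lam: "0 \<le> lam (min q1 q2)" "q1 < q2 \<Longrightarrow> 0 < lam q1"
  shows "filterlim (dominant lam q1 q2) at_top at_top"
proof (cases "q2 \<le> q1")
  case True
  show ?thesis
  proof (rule filterlim_at_top_mono[OF filterlim_ident])
    show "\<forall>\<^sub>F t in at_top. t \<le> dominant lam q1 q2 t"
      using eventually_ge_at_top[of 0]
    proof eventually_elim
      case (elim t)
      have "t \<le> exp_avg (lam q2) t" using lam(1) True elim by (intro exp_avg_ge) (auto simp: min_def split: if_splits)
      then show ?case using True by (auto simp: dominant_def add_increasing)
    qed
  qed
next
  case False
  then have "0 < lam q1" using lam by simp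
  then have "filterlim (\<lambda>t. exp (lam q1 * t)) at_top at_top" by real_asymp
  then show ?thesis using False by (simp add: dominant_def[abs_def])
qed

text \<open>\<open>T1\<close>, \<open>T2\<close> and \<kappa> are left abstract to serve twice: for
  the flows, with \<kappa> constantly 1, and for their derivatives in u, with \<kappa> p = p -
  1.\<close>

lemma total_asymptotics:
  fixes lam u :: "real \<Rightarrow> real"
  assumes q: "q1 < 1" "q2 < 1"
    and gap: "\<And>p m. p < m \<Longrightarrow> m < 1 \<Longrightarrow> lam m * (1 - p) < lam p * (1 - m)"
    and lam: "0 \<le> lam (min q1 q2)" "q1 < q2 \<Longrightarrow> 0 < lam q1"
    and T1: "\<And>m. q1 < m \<Longrightarrow> m < 1 \<Longrightarrow> 0 \<le> m \<Longrightarrow> asymp_power lam T1 (\<kappa> q1) q1 m"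
    and T2: "\<And>m. q2 < m \<Longrightarrow> m < 1 \<Longrightarrow> 0 \<le> m \<Longrightarrow> asymp_power lam T2 (\<kappa> q2) q2 m"
    and int: "\<And>u t. set_integrable lborel {0<..t} (T2 u)"
    and u: "((\<lambda>t. exp ((min q1 q2 - 1) * u t) * dominant lam q1 q2 t) \<longlongrightarrow> k) at_top" "0 < k"
  shows "((\<lambda>t. T1 (u t) t + (LBINT \<tau>:{0<..t}. T2 (u t) \<tau>)) \<longlongrightarrow> \<kappa> (min q1 q2) * k) at_top"
proof -
  let ?q = "min q1 q2" and ?E = "dominant lam q1 q2"
  \<comment> \<open>One exponent above both q1 and q2, so that it can carry the error terms of
    \<open>T1\<close> and of \<open>T2\<close>.\<close>
  define m where "m = max ((1 + max q1 q2) / 2) 0"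
  have m: "q1 < m" "q2 < m" "m < 1" "0 \<le> m" using q by (auto simp: m_def less_max_iff_disj)
  have Etop: "filterlim ?E at_top at_top" by (rule dominant_at_top[OF lam])
  obtain c where c: "0 < c" "\<forall>\<^sub>F t in at_top. c * exp (lam ?q * t) \<le> ?E t"
  proof (cases "q1 \<le> q2")
    case True
    have "\<forall>\<^sub>F t in at_top. 1 * exp (lam ?q * t) \<le> ?E t"
      using eventually_ge_at_top[of 0]
      by eventually_elim (use True in \<open>auto simp: dominant_def min_def exp_avg_nonneg\<close>)
    then show ?thesis using that[of 1] by simp
  next
    case False
    then obtain c where "0 < c" "\<And>t. 1 \<le> t \<Longrightarrow> c * exp (lam q2 * t) \<le> exp_avg (lam q2) t"
      using exp_avg_ge_exp[of "lam q2"] lam(1) by auto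
    then have "c * exp (lam ?q * t) \<le> ?E t" if "1 \<le> t" for t
      using False that by (simp add: dominant_def min_def)
    then have "\<forall>\<^sub>F t in at_top. c * exp (lam ?q * t) \<le> ?E t"
      by (rule eventually_mono[OF eventually_ge_at_top[of 1]])
    then show ?thesis using that \<open>0 < c\<close> by blast
  qed
  have van: "((\<lambda>t. exp ((p - 1) * u t) * F t) \<longlongrightarrow> 0) at_top"
    if "?q < p" "p < 1" "F = (\<lambda>t. exp (lam p * t)) \<or> F = exp_avg (lam p)" for p F
    by (rule subdominant_vanishes[OF that(1,2) Etop c lam(1) gap[OF that(1,2)] u that(3)])
  have bd: "\<forall>\<^sub>F t in at_top. exp ((?q - 1) * u t) * ?E t \<le> k + 1"
    using order_tendstoD(2)[OF u(1), of "k + 1"] by (auto elim: eventually_mono)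
  \<comment> \<open>Either q1 is the smaller exponent and this term is part of the convergent
    dominant one, or it is subdominant and vanishes. The same alternative gives
    \<open>le2\<close>.\<close>
  have le1: "\<forall>\<^sub>F t in at_top. exp ((q1 - 1) * u t + lam q1 * t) \<le> k + 1"
  proof (cases "q1 \<le> q2")
    case True
    show ?thesis using bd eventually_ge_at_top[of 0]
    proof eventually_elim
      case (elim t)
      have "exp ((q1 - 1) * u t) * exp (lam q1 * t) \<le> exp ((q1 - 1) * u t) * ?E t"
        using True elim by (intro mult_left_mono) (auto simp: dominant_def exp_avg_nonneg)
      also have "\<dots> \<le> k + 1" using elim True by (simp add: min_def)
      finally show ?case by (simp add: exp_add)
    qed
  next
    case False
    then have "((\<lambda>t. exp ((q1 - 1) * u t) * exp (lam q1 * t)) \<longlongrightarrow> 0) at_top" using q by (intro van) auto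
    then have "\<forall>\<^sub>F t in at_top. exp ((q1 - 1) * u t) * exp (lam q1 * t) < k + 1"
      by (rule order_tendstoD) (use u in simp)
    then show ?thesis by eventually_elim (simp add: exp_add)
  qed
  have le2: "\<forall>\<^sub>F t in at_top. exp ((q2 - 1) * u t) * exp_avg (lam q2) t \<le> k + 1"
  proof (cases "q2 \<le> q1")
    case True
    show ?thesis using bd eventually_ge_at_top[of 0]
    proof eventually_elim
      case (elim t)
      have "exp ((q2 - 1) * u t) * exp_avg (lam q2) t \<le> exp ((q2 - 1) * u t) * ?E t"
        using True elim by (intro mult_left_mono) (auto simp: dominant_def)
      also have "\<dots> \<le> k + 1" using elim True by (simp add: min.absorb2)
      finally show ?case .
    qed
  next
    case False
    then have "((\<lambda>t. exp ((q2 - 1) * u t) * exp_avg (lam q2) t) \<longlongrightarrow> 0) at_top" using q by (intro van) auto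
    then have "\<forall>\<^sub>F t in at_top. exp ((q2 - 1) * u t) * exp_avg (lam q2) t < k + 1"
      by (rule order_tendstoD) (use u in simp)
    then show ?thesis by eventually_elim simp
  qed
  have "((\<lambda>t. T1 (u t) t - \<kappa> q1 * exp ((q1 - 1) * u t + lam q1 * t)) \<longlongrightarrow> 0) at_top"
    using van[of m "\<lambda>t. exp (lam m * t)"] m
    by (intro asymp_power_tendsto[OF T1 le1, of m]) (auto simp: exp_add)
  moreover have "((\<lambda>t. (LBINT \<tau>:{0<..t}. T2 (u t) \<tau>)
      - \<kappa> q2 * (exp ((q2 - 1) * u t) * exp_avg (lam q2) t)) \<longlongrightarrow> 0) at_top"
    using van[of m "exp_avg (lam m)"] m
    by (intro asymp_power_integral_tendsto[OF T2 int le2, of m]) auto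
  moreover have "((\<lambda>t. \<kappa> q1 * exp ((q1 - 1) * u t + lam q1 * t)
      + \<kappa> q2 * (exp ((q2 - 1) * u t) * exp_avg (lam q2) t)) \<longlongrightarrow> \<kappa> ?q * k) at_top"
  proof (cases q1 q2 rule: linorder_cases)
    case less
    have "((\<lambda>t. \<kappa> q1 * (exp ((?q - 1) * u t) * ?E t) + \<kappa> q2 * (exp ((q2 - 1) * u t) * exp_avg (lam q2) t))
        \<longlongrightarrow> \<kappa> q1 * k + \<kappa> q2 * 0) at_top"
      using less q by (intro tendsto_intros u van) auto
    then show ?thesis using less by (simp add: dominant_def exp_add)
  next
    case equal
    have "((\<lambda>t. \<kappa> q1 * (exp ((?q - 1) * u t) * ?E t)) \<longlongrightarrow> \<kappa> q1 * k) at_top"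
      by (intro tendsto_intros u)
    then show ?thesis using equal by (simp add: dominant_def exp_add distrib_left)
  next
    case greater
    have "((\<lambda>t. \<kappa> q1 * (exp ((q1 - 1) * u t) * exp (lam q1 * t)) + \<kappa> q2 * (exp ((?q - 1) * u t) * ?E t))
        \<longlongrightarrow> \<kappa> q1 * 0 + \<kappa> q2 * k) at_top"
      using greater q by (intro tendsto_intros u van) auto
    then show ?thesis using greater by (simp add: dominant_def exp_add)
  qed
  ultimately have "((\<lambda>t. (T1 (u t) t - \<kappa> q1 * exp ((q1 - 1) * u t + lam q1 * t))
      + ((LBINT \<tau>:{0<..t}. T2 (u t) \<tau>) - \<kappa> q2 * (exp ((q2 - 1) * u t) * exp_avg (lam q2) t))
      + (\<kappa> q1 * exp ((q1 - 1) * u t + lam q1 * t)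
      + \<kappa> q2 * (exp ((q2 - 1) * u t) * exp_avg (lam q2) t))) \<longlongrightarrow> 0 + 0 + \<kappa> ?q * k) at_top"
    by (intro tendsto_add)
  then show "((\<lambda>t. T1 (u t) t + (LBINT \<tau>:{0<..t}. T2 (u t) \<tau>)) \<longlongrightarrow> \<kappa> ?q * k) at_top"
    by simp
qed

section \<open>The optimal strategies\<close>

lemma growth_rate_lambda_c:
  "growth_rate (alpha_c r \<delta> \<theta>) (a_c \<theta>) (beta_c r \<delta> \<theta>) = lambda_c r \<delta> \<theta>"
  by (simp add: growth_rate_def[abs_def] lambda_c_def[abs_def])

lemma lambda_c_eq:
  assumes "\<theta> \<noteq> 0"
  shows "lambda_c r \<delta> \<theta> q = \<theta>\<^sup>2 * q * (q - 1) / 2 - r * q + \<delta> * (q - 1)"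
proof -
  have *: "\<theta>\<^sup>2 * alpha_c r \<delta> \<theta> = \<theta>\<^sup>2 / 2 + (r - \<delta>)"
    using assms by (simp add: alpha_c_def field_simps)
  have "lambda_c r \<delta> \<theta> q = \<theta>\<^sup>2 * q\<^sup>2 / 2 - q * (\<theta>\<^sup>2 * alpha_c r \<delta> \<theta>) - \<delta>"
    by (simp add: lambda_c_def beta_c_def a_c_def power_divide power2_diff field_simps)
  then show ?thesis unfolding * by (simp add: power2_eq_square field_simps)
qed

text \<open>\<lambda>(q) / (1 - q) equals - \<theta>^2 * q / 2 - r * q / (1 - q) - \<delta>, where
  both q and q / (1 - q) increase on q < 1; the inequality is its strict decrease,
  cross-multiplied.\<close>

lemma lambda_c_gap:
  assumes "\<theta> \<noteq> 0" "0 < r" "p < m" "m < 1"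
  shows "lambda_c r \<delta> \<theta> m * (1 - p) < lambda_c r \<delta> \<theta> p * (1 - m)"
proof -
  have "lambda_c r \<delta> \<theta> p * (1 - m) - lambda_c r \<delta> \<theta> m * (1 - p)
      = (1 - p) * (1 - m) * (m - p) * \<theta>\<^sup>2 / 2 + r * (m - p)"
    unfolding lambda_c_eq[OF assms(1)] by (simp add: field_simps)
  also have "\<dots> > 0" using assms by (intro add_nonneg_pos) auto
  finally show ?thesis by simp
qed

lemma lambda_c_q_star:
  assumes "\<theta> \<noteq> 0" "0 < \<delta>"
  shows "q \<le> q_star r \<delta> \<theta> \<Longrightarrow> 0 \<le> lambda_c r \<delta> \<theta> q"
    and "q < q_star r \<delta> \<theta> \<Longrightarrow> 0 < lambda_c r \<delta> \<theta> q"
proof -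
  define \<alpha> where "\<alpha> = alpha_c r \<delta> \<theta>"
  define D where "D = \<alpha>\<^sup>2 + 2 * \<delta> / \<theta>\<^sup>2"
  have D: "0 \<le> D" using assms by (simp add: D_def)
  have lam: "lambda_c r \<delta> \<theta> q = ((\<alpha> - q)\<^sup>2 - D) * \<theta>\<^sup>2 / 2" for q
    using assms by (simp add: lambda_c_def beta_c_def a_c_def D_def \<alpha>_def power_divide field_simps)
  have qs: "q_star r \<delta> \<theta> = \<alpha> - sqrt D" by (simp add: q_star_def \<alpha>_def D_def)
  show "0 \<le> lambda_c r \<delta> \<theta> q" if "q \<le> q_star r \<delta> \<theta>"
  proof -
    have "(sqrt D)\<^sup>2 \<le> (\<alpha> - q)\<^sup>2" using that D by (intro power_mono) (auto simp: qs)
    then show ?thesis using D by (simp add: lam)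
  qed
  show "0 < lambda_c r \<delta> \<theta> q" if "q < q_star r \<delta> \<theta>"
  proof -
    have "(sqrt D)\<^sup>2 < (\<alpha> - q)\<^sup>2" using that D by (intro power_strict_mono) (auto simp: qs)
    then show ?thesis using D assms by (simp add: lam)
  qed
qed

text \<open>The root is bracketed by explicit paths: \<open>w k\<close> solves exp ((q - 1) * u) * E
  t = k, and along it \<open>S\<close> tends to k. For k1 < x < k2 the value x is thus eventually
  crossed between \<open>w k2\<close> and \<open>w k1\<close>, once by strict monotonicity, and k1,
  k2 may be taken close to x.\<close>

lemma root_asymptotics:
  fixes S :: "real \<Rightarrow> real \<Rightarrow> real" and E :: "real \<Rightarrow> real"
  assumes cont: "\<And>t. 0 < t \<Longrightarrow> continuous_on UNIV (\<lambda>u. S u t)"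
    and dec: "\<And>t u v. 0 < t \<Longrightarrow> u < v \<Longrightarrow> S v t < S u t"
    and q: "q < 1"
    and E: "\<forall>\<^sub>F t in at_top. 0 < E t"
    and lim: "\<And>u k. ((\<lambda>t. exp ((q - 1) * u t) * E t) \<longlongrightarrow> k) at_top \<Longrightarrow> 0 < k \<Longrightarrow> ((\<lambda>t. S (u t) t) \<longlongrightarrow> k) at_top"
    and x: "0 < x"
  shows "\<exists>u. (\<forall>\<^sub>F t in at_top. \<forall>v. S v t = x \<longleftrightarrow> v = u t) \<and>
      ((\<lambda>t. exp ((q - 1) * u t) * E t) \<longlongrightarrow> x) at_top"
proof -
  define w where "w k t = (ln k - ln (E t)) / (q - 1)" for k t
  have w: "exp ((q - 1) * w k t) * E t = k" if "0 < k" "0 < E t" for k t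
    using that q by (simp add: w_def exp_diff)
  have Sw: "((\<lambda>t. S (w k t) t) \<longlongrightarrow> k) at_top" if "0 < k" for k
    by (rule lim[OF _ that], rule tendsto_eventually, rule eventually_mono[OF E]) (simp add: w that)
  have inj: "u = v" if "0 < t" "S u t = S v t" for t u v
    using dec[OF that(1), of u v] dec[OF that(1), of v u] that(2) by (cases u v rule: linorder_cases) auto
  have between: "\<forall>\<^sub>F t in at_top. \<exists>v. (\<forall>v'. S v' t = x \<longleftrightarrow> v' = v) \<and>
      k1 < exp ((q - 1) * v) * E t \<and> exp ((q - 1) * v) * E t < k2"
    if k: "0 < k1" "k1 < x" "x < k2" for k1 k2
    using order_tendstoD(2)[OF Sw[OF k(1)] k(2)] order_tendstoD(1)[OF Sw[OF order.strict_trans[OF k(1) order.strict_trans[OF k(2,3)]]] k(3)] E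
      eventually_gt_at_top[of 0]
  proof eventually_elim
    case (elim t)
    have lt: "w k2 t < w k1 t"
      using dec[OF elim(4), of "w k1 t" "w k2 t"] elim k by (cases "w k1 t" "w k2 t" rule: linorder_cases) auto
    have "\<exists>v. w k2 t \<le> v \<and> v \<le> w k1 t \<and> S v t = x"
      using elim lt by (intro IVT2') (auto intro: continuous_on_subset[OF cont])
    then obtain v where v: "w k2 t \<le> v" "v \<le> w k1 t" "S v t = x" by auto
    have v': "w k2 t < v" "v < w k1 t" using v elim k by (auto simp: order.order_iff_strict)
    have "exp ((q - 1) * w k1 t) * E t < exp ((q - 1) * v) * E t"
      using v' q elim by (intro mult_strict_right_mono) auto
    moreover have "exp ((q - 1) * v) * E t < exp ((q - 1) * w k2 t) * E t"
      using v' q elim by (intro mult_strict_right_mono) auto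
    ultimately show ?case using v(3) inj[OF elim(4)] k elim by (intro exI[of _ v]) (auto simp: w)
  qed
  define u where "u t = (THE v. S v t = x)" for t
  have root: "\<forall>\<^sub>F t in at_top. (\<forall>v. S v t = x \<longleftrightarrow> v = u t) \<and>
      k1 < exp ((q - 1) * u t) * E t \<and> exp ((q - 1) * u t) * E t < k2"
    if "0 < k1" "k1 < x" "x < k2" for k1 k2
    using between[OF that]
  proof eventually_elim
    case (elim t)
    then obtain v where v: "\<And>v'. S v' t = x \<longleftrightarrow> v' = v"
      "k1 < exp ((q - 1) * v) * E t" "exp ((q - 1) * v) * E t < k2" by auto
    then have "u t = v" unfolding u_def by (intro the_equality) auto
    then show ?case using v by auto
  qed
  have "((\<lambda>t. exp ((q - 1) * u t) * E t) \<longlongrightarrow> x) at_top"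
  proof (rule order_tendstoI)
    fix l assume "l < x"
    \<comment> \<open>The lower bracket must be positive for its path to exist, whereas l need not
      be.\<close>
    moreover have "0 < max l (x / 2)" using x by (simp add: less_max_iff_disj)
    ultimately show "\<forall>\<^sub>F t in at_top. l < exp ((q - 1) * u t) * E t"
      using root[of "max l (x / 2)" "x + 1"] x by (auto elim!: eventually_mono)
  next
    fix l assume "x < l"
    then show "\<forall>\<^sub>F t in at_top. exp ((q - 1) * u t) * E t < l"
      using root[of "x / 2" l] x by (auto elim!: eventually_mono)
  qed
  moreover have "\<forall>\<^sub>F t in at_top. \<forall>v. S v t = x \<longleftrightarrow> v = u t"
    using root[of "x / 2" "x + 1"] x by (auto elim!: eventually_mono)
  ultimately show ?thesis by blast
qed

section \<open>Translation of the given formulas into the coordinate u = ln y\<close>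

lemma I_fun_flow:
  assumes "0 < y"
  shows "I_fun r \<delta> \<theta> U y t = flow (alpha_c r \<delta> \<theta>) (a_c \<theta>) (beta_c r \<delta> \<theta>)
     (\<lambda>s. \<bar>deriv (dual_fun U) (exp s)\<bar>) (ln y) t"
  using assms by (simp add: I_fun_def flow_def gauss_avg_def exp_add mult.assoc)

lemma v_y_flow:
  assumes "0 < y" and \<phi>: "exp_growth (\<lambda>s. \<bar>deriv (dual_fun U\<^sub>2) (exp s)\<bar>)"
  shows "v_y r \<delta> \<theta> U\<^sub>1 U\<^sub>2 y t = - (I_fun r \<delta> \<theta> U\<^sub>1 y t + (LBINT \<tau>:{0<..t}. I_fun r \<delta> \<theta> U\<^sub>2 y \<tau>))"
proof -
  have [measurable]: "(\<lambda>\<tau>. I_fun r \<delta> \<theta> U\<^sub>2 y \<tau>) \<in> borel_measurable borel"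
    unfolding I_fun_flow[OF assms(1)] using measurable_flow(1)[OF \<phi>] by simp
  have "(LBINT \<tau>:{0..t}. I_fun r \<delta> \<theta> U\<^sub>2 y \<tau>) = (LBINT \<tau>:{0<..t}. I_fun r \<delta> \<theta> U\<^sub>2 y \<tau>)"
    unfolding set_lebesgue_integral_def using AE_lborel_singleton[of 0]
    by (intro integral_cong_AE) (auto simp: indicator_def elim!: eventually_mono)
  then show ?thesis by (simp add: v_y_def)
qed

text \<open>For q1 < q2 the extra power (q2 - 1) / (q1 - 1) in R cancels q2 - 1 in the outer
  exponent and leaves q1 - 1; in the other cases q2 is the minimum already.\<close>

lemma R_fun_dominant:
  assumes "q\<^sub>1 < 1" "q\<^sub>2 < 1"
  shows "R_fun r \<delta> \<theta> q\<^sub>1 q\<^sub>2 t powr ((q\<^sub>h - 1) / (q\<^sub>2 - 1))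
     = dominant (lambda_c r \<delta> \<theta>) q\<^sub>1 q\<^sub>2 t powr ((q\<^sub>h - 1) / (min q\<^sub>1 q\<^sub>2 - 1))"
  using assms by (cases q\<^sub>1 q\<^sub>2 rule: linorder_cases) (auto simp: R_fun_def dominant_def powr_def)

theorem theorem2p4:
  fixes r \<delta> \<mu> \<sigma> \<theta> q\<^sub>1 q\<^sub>2 :: real and U\<^sub>1 U\<^sub>2 :: "real \<Rightarrow> real"
  assumes "0 < r" "0 < \<delta>" "0 < \<mu>" "0 < \<sigma>"
    and "\<theta> = (\<mu> - r) / \<sigma>" "\<theta> \<noteq> 0"
    and "is_utility U\<^sub>1" "is_utility U\<^sub>2"
    and "q\<^sub>1 < 1" "q\<^sub>2 < 1"
    and "q\<^sub>1 < q_star r \<delta> \<theta> \<or> q\<^sub>2 \<le> q_star r \<delta> \<theta>"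
    and "dual_fun U\<^sub>1 C1_differentiable_on {0<..}"
    and "dual_fun U\<^sub>2 C1_differentiable_on {0<..}"
    and "((\<lambda>y. deriv (dual_fun U\<^sub>1) y / y powr (q\<^sub>1 - 1)) \<longlongrightarrow> -1) (at_right 0)"
    and "((\<lambda>y. deriv (dual_fun U\<^sub>2) y / y powr (q\<^sub>2 - 1)) \<longlongrightarrow> -1) (at_right 0)"
  shows "(\<forall>x>0. ((\<lambda>t. risky_amount r \<delta> \<sigma> \<theta> U\<^sub>1 U\<^sub>2 x t)
                   \<longlongrightarrow> \<theta> / \<sigma> * (1 - min q\<^sub>1 q\<^sub>2) * x) at_top) \<and>
         (\<forall>q\<^sub>h<0. ((\<lambda>y. deriv (dual_fun U\<^sub>2) y / y powr (q\<^sub>h - 1)) \<longlongrightarrow> -1) at_top \<longrightarrow>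
            (\<forall>x>0. ((\<lambda>t. R_fun r \<delta> \<theta> q\<^sub>1 q\<^sub>2 t powr ((q\<^sub>h - 1) / (q\<^sub>2 - 1)) *
                            consumption r \<delta> \<theta> U\<^sub>1 U\<^sub>2 x t)
                      \<longlongrightarrow> x powr ((q\<^sub>h - 1) / (min q\<^sub>1 q\<^sub>2 - 1))) at_top))"
proof -
  define \<phi>\<^sub>1 where "\<phi>\<^sub>1 s = \<bar>deriv (dual_fun U\<^sub>1) (exp s)\<bar>" for s
  define \<phi>\<^sub>2 where "\<phi>\<^sub>2 s = \<bar>deriv (dual_fun U\<^sub>2) (exp s)\<bar>" for s
  define \<alpha> where "\<alpha> = alpha_c r \<delta> \<theta>"
  define a where "a = a_c \<theta>"
  define \<beta> where "\<beta> = beta_c r \<delta> \<theta>"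
  define lam where "lam = lambda_c r \<delta> \<theta>"
  define q where "q = min q\<^sub>1 q\<^sub>2"
  define E where "E = dominant lam q\<^sub>1 q\<^sub>2"
  \<comment> \<open>\<open>S\<close> is - v_y at y = exp u, and \<open>D\<close> is its derivative
    in u, so that y * v_yy = - D.\<close>
  define S where "S u t = flow \<alpha> a \<beta> \<phi>\<^sub>1 u t + (LBINT \<tau>:{0<..t}. flow \<alpha> a \<beta> \<phi>\<^sub>2 u \<tau>)" for u t
  define D where "D u t = flow_deriv \<alpha> a \<beta> \<phi>\<^sub>1 u t + (LBINT \<tau>:{0<..t}. flow_deriv \<alpha> a \<beta> \<phi>\<^sub>2 u \<tau>)" for u t
  have a0: "a \<noteq> 0" using \<open>\<theta> \<noteq> 0\<close> by (simp add: a_def a_c_def)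
  have lam_eq: "growth_rate \<alpha> a \<beta> = lam"
    unfolding \<alpha>_def a_def \<beta>_def lam_def by (rule growth_rate_lambda_c)
  have m1: "marginal \<phi>\<^sub>1 q\<^sub>1" unfolding \<phi>\<^sub>1_def[abs_def] by (intro marginal_dual_fun assms)
  have m2: "marginal \<phi>\<^sub>2 q\<^sub>2" unfolding \<phi>\<^sub>2_def[abs_def] by (intro marginal_dual_fun assms)
  note gr1 = marginal_exp_growth[OF m1 \<open>q\<^sub>1 < 1\<close>] and gr2 = marginal_exp_growth[OF m2 \<open>q\<^sub>2 < 1\<close>]
  have q: "q < 1" using assms by (simp add: q_def)
  \<comment> \<open>If \<open>q\<^sub>1 < q\<^sub>2\<close>, either alternative of the threshold
    hypothesis puts \<open>q\<^sub>1\<close> strictly below \<open>q_star\<close>; otherwise either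
    one gives \<open>q\<^sub>2\<close> at most \<open>q_star\<close>.\<close>
  have lam_nonneg: "0 \<le> lam (min q\<^sub>1 q\<^sub>2)"
    unfolding lam_def using assms(11) by (intro lambda_c_q_star assms) auto
  have lam_pos: "0 < lam q\<^sub>1" if "q\<^sub>1 < q\<^sub>2"
    unfolding lam_def using assms(11) that by (intro lambda_c_q_star assms) auto
  have gap: "lam m * (1 - p) < lam p * (1 - m)" if "p < m" "m < 1" for p m
    unfolding lam_def by (intro lambda_c_gap assms that)
  have E_top: "filterlim E at_top at_top" unfolding E_def by (rule dominant_at_top[OF lam_nonneg lam_pos])
  then have E_pos: "\<forall>\<^sub>F t in at_top. 0 < E t" by (simp add: filterlim_at_top_dense)
  note flow1 = asymp_power_flow[OF m1 _ _ _ a0, where \<alpha> = \<alpha> and \<beta> = \<beta>, unfolded lam_eq]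
    and flow2 = asymp_power_flow[OF m2 _ _ _ a0, where \<alpha> = \<alpha> and \<beta> = \<beta>, unfolded lam_eq]
    and int2 = set_integrable_flow[OF m2 \<open>q\<^sub>2 < 1\<close> a0]
  have S_lim: "((\<lambda>t. S (u t) t) \<longlongrightarrow> k) at_top" and D_lim: "((\<lambda>t. D (u t) t) \<longlongrightarrow> (q - 1) * k) at_top"
    if "((\<lambda>t. exp ((q - 1) * u t) * E t) \<longlongrightarrow> k) at_top" "0 < k" for u k
    using total_asymptotics[OF \<open>q\<^sub>1 < 1\<close> \<open>q\<^sub>2 < 1\<close> gap lam_nonneg lam_pos, where \<kappa> = "\<lambda>_. 1", OF _ _ _ flow1(1) flow2(1) int2(1) that[unfolded q_def E_def]]
      total_asymptotics[OF \<open>q\<^sub>1 < 1\<close> \<open>q\<^sub>2 < 1\<close> gap lam_nonneg lam_pos, where \<kappa> = "\<lambda>p. p - 1", OF _ _ _ flow1(2) flow2(2) int2(2) that[unfolded q_def E_def]]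
    by (simp_all add: S_def D_def E_def q_def)
  have S_deriv: "((\<lambda>u. S u t) has_real_derivative D u t) (at u)" if "0 < t" for u t
    unfolding S_def D_def
    by (intro DERIV_add has_real_derivative_flow gr1 a0 that has_real_derivative_integral_flow[OF m2 \<open>q\<^sub>2 < 1\<close>])
  have S_dec: "S v t < S u t" if "0 < t" "u < v" for u v t
    unfolding S_def using that
    by (intro add_less_le_mono flow_strict_antimono[OF m1 \<open>q\<^sub>1 < 1\<close> a0] set_integral_mono int2(1)
        flow_antimono[OF m2 \<open>q\<^sub>2 < 1\<close>]) auto
  have S_cont: "continuous_on UNIV (\<lambda>u. S u t)" if "0 < t" for t
    using DERIV_isCont[OF S_deriv[OF that]] by (simp add: continuous_at_imp_continuous_on)
  have v_y_eq: "v_y r \<delta> \<theta> U\<^sub>1 U\<^sub>2 y t = - S (ln y) t" if "0 < y" for y t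
    unfolding S_def \<alpha>_def a_def \<beta>_def \<phi>\<^sub>1_def[abs_def] \<phi>\<^sub>2_def[abs_def]
    using gr2 that by (simp add: v_y_flow I_fun_flow \<phi>\<^sub>2_def[abs_def])
  have v_yy: "deriv (\<lambda>z. v_y r \<delta> \<theta> U\<^sub>1 U\<^sub>2 z t) (exp u) = - D u t / exp u" if "0 < t" for u t
  proof (rule DERIV_imp_deriv)
    have "((\<lambda>z. - S (ln z) t) has_real_derivative - (D (ln (exp u)) t * (1 / exp u))) (at (exp u))"
      by (intro DERIV_minus DERIV_chain2[OF S_deriv[OF that]]) (auto intro!: derivative_eq_intros)
    then have "((\<lambda>z. - S (ln z) t) has_real_derivative - D u t / exp u) (at (exp u))" by simp
    then show "((\<lambda>z. v_y r \<delta> \<theta> U\<^sub>1 U\<^sub>2 z t) has_real_derivative - D u t / exp u) (at (exp u))"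
      by (rule has_field_derivative_transform_within_open[where S = "{0<..}"]) (auto simp: v_y_eq)
  qed
  \<comment> \<open>The \<open>THE\<close> in \<open>y_sol\<close> is resolved only for large t,
    which is all that a limit in t sees.\<close>
  have sol: "\<exists>u. (\<forall>\<^sub>F t in at_top. 0 < t \<and> y_sol r \<delta> \<theta> U\<^sub>1 U\<^sub>2 x t = exp (u t)) \<and>
      ((\<lambda>t. exp ((q - 1) * u t) * E t) \<longlongrightarrow> x) at_top" if x: "0 < x" for x
  proof -
    obtain u where u: "\<forall>\<^sub>F t in at_top. \<forall>v. S v t = x \<longleftrightarrow> v = u t"
      "((\<lambda>t. exp ((q - 1) * u t) * E t) \<longlongrightarrow> x) at_top"
      using root_asymptotics[OF S_cont S_dec q E_pos S_lim x] by blast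
    have "\<forall>\<^sub>F t in at_top. 0 < t \<and> y_sol r \<delta> \<theta> U\<^sub>1 U\<^sub>2 x t = exp (u t)"
      using u(1) eventually_gt_at_top[of 0]
    proof eventually_elim
      case (elim t)
      have "y_sol r \<delta> \<theta> U\<^sub>1 U\<^sub>2 x t = exp (u t)"
        unfolding y_sol_def
      proof (rule the_equality)
        have "S (u t) t = x" using elim by blast
        then show "0 < exp (u t) \<and> x = - v_y r \<delta> \<theta> U\<^sub>1 U\<^sub>2 (exp (u t)) t"
          by (simp add: v_y_eq)
        fix y assume "0 < y \<and> x = - v_y r \<delta> \<theta> U\<^sub>1 U\<^sub>2 y t"
        then have "0 < y" "ln y = u t" using elim by (auto simp: v_y_eq)
        then show "y = exp (u t)" by (metis exp_ln)
      qed
      then show ?case using elim by simp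
    qed
    then show ?thesis using u(2) by blast
  qed
  show ?thesis
  proof (intro conjI allI impI)
    fix x :: real assume x: "0 < x"
    obtain u where u: "\<forall>\<^sub>F t in at_top. 0 < t \<and> y_sol r \<delta> \<theta> U\<^sub>1 U\<^sub>2 x t = exp (u t)"
      "((\<lambda>t. exp ((q - 1) * u t) * E t) \<longlongrightarrow> x) at_top"
      using sol[OF x] by blast
    have "((\<lambda>t. \<theta> / \<sigma> * - D (u t) t) \<longlongrightarrow> \<theta> / \<sigma> * - ((q - 1) * x)) at_top"
      by (intro tendsto_intros D_lim u(2) x)
    moreover have "\<forall>\<^sub>F t in at_top. \<theta> / \<sigma> * - D (u t) t = risky_amount r \<delta> \<sigma> \<theta> U\<^sub>1 U\<^sub>2 x t"
      using u(1) by eventually_elim (simp add: risky_amount_def Let_def v_yy)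
    ultimately have "((\<lambda>t. risky_amount r \<delta> \<sigma> \<theta> U\<^sub>1 U\<^sub>2 x t) \<longlongrightarrow> \<theta> / \<sigma> * - ((q - 1) * x)) at_top"
      by (rule Lim_transform_eventually)
    moreover have "\<theta> / \<sigma> * - ((q - 1) * x) = \<theta> / \<sigma> * (1 - min q\<^sub>1 q\<^sub>2) * x"
      unfolding q_def by algebra
    ultimately show "((\<lambda>t. risky_amount r \<delta> \<sigma> \<theta> U\<^sub>1 U\<^sub>2 x t) \<longlongrightarrow> \<theta> / \<sigma> * (1 - min q\<^sub>1 q\<^sub>2) * x) at_top"
      by (simp only:)
  next
    fix q\<^sub>h x :: real
    assume lim: "((\<lambda>y. deriv (dual_fun U\<^sub>2) y / y powr (q\<^sub>h - 1)) \<longlongrightarrow> -1) at_top" and x: "0 < x"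
    obtain u where u: "\<forall>\<^sub>F t in at_top. 0 < t \<and> y_sol r \<delta> \<theta> U\<^sub>1 U\<^sub>2 x t = exp (u t)"
      "((\<lambda>t. exp ((q - 1) * u t) * E t) \<longlongrightarrow> x) at_top"
      using sol[OF x] by blast
    define \<rho> where "\<rho> = (q\<^sub>h - 1) / (q - 1)"
    \<comment> \<open>Since \<open>E\<close> is unbounded while its product with exp ((q - 1) * u)
      converges, y = exp u tends to infinity. This is why consumption is governed by the behaviour
      of the dual function at infinity.\<close>
    have "((\<lambda>t. exp ((q - 1) * u t) * E t / E t) \<longlongrightarrow> 0) at_top"
      by (rule tendsto_divide_0[OF u(2) filterlim_at_top_imp_at_infinity[OF E_top]])
    then have "((\<lambda>t. exp ((q - 1) * u t)) \<longlongrightarrow> 0) at_top"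
      by (rule Lim_transform_eventually) (rule eventually_mono[OF E_pos], simp)
    then have "\<forall>\<^sub>F t in at_top. exp ((q - 1) * u t) < exp ((q - 1) * Z)" for Z
      by (rule order_tendstoD) simp
    then have "\<forall>\<^sub>F t in at_top. Z < u t" for Z
      by (rule eventually_mono) (use q in simp)
    then have "filterlim u at_top at_top" by (simp add: filterlim_at_top_dense)
    then have u_top: "filterlim (\<lambda>t. exp (u t)) at_top at_top"
      by (rule filterlim_compose[OF exp_at_top])
    \<comment> \<open>The exponent \<rho> is chosen so that exp ((q - 1) * u) to the power \<rho> is
      y to the power \<open>q\<^sub>h - 1\<close>. It cancels the denominator and leaves consumption
      times \<open>E t powr \<rho>\<close>.\<close>
    have "((\<lambda>t. - (deriv (dual_fun U\<^sub>2) (exp (u t)) / exp (u t) powr (q\<^sub>h - 1))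
        * (exp ((q - 1) * u t) * E t) powr \<rho>) \<longlongrightarrow> - (- 1) * x powr \<rho>) at_top"
      using x by (intro tendsto_mult tendsto_minus filterlim_compose[OF lim u_top] tendsto_powr u(2) tendsto_const) auto
    moreover have "\<forall>\<^sub>F t in at_top. - (deriv (dual_fun U\<^sub>2) (exp (u t)) / exp (u t) powr (q\<^sub>h - 1))
        * (exp ((q - 1) * u t) * E t) powr \<rho>
        = R_fun r \<delta> \<theta> q\<^sub>1 q\<^sub>2 t powr ((q\<^sub>h - 1) / (q\<^sub>2 - 1)) * consumption r \<delta> \<theta> U\<^sub>1 U\<^sub>2 x t"
      using u(1) E_pos
    proof eventually_elim
      case (elim t)
      have "(exp ((q - 1) * u t) * E t) powr \<rho> = exp (u t) powr (q\<^sub>h - 1) * E t powr \<rho>"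
        using elim q by (simp add: powr_mult) (simp add: powr_def \<rho>_def)
      moreover have "R_fun r \<delta> \<theta> q\<^sub>1 q\<^sub>2 t powr ((q\<^sub>h - 1) / (q\<^sub>2 - 1)) = E t powr \<rho>"
        unfolding R_fun_dominant[OF \<open>q\<^sub>1 < 1\<close> \<open>q\<^sub>2 < 1\<close>] E_def lam_def \<rho>_def q_def ..
      ultimately show ?case using elim by (simp add: consumption_def)
    qed
    ultimately have "((\<lambda>t. R_fun r \<delta> \<theta> q\<^sub>1 q\<^sub>2 t powr ((q\<^sub>h - 1) / (q\<^sub>2 - 1)) *
        consumption r \<delta> \<theta> U\<^sub>1 U\<^sub>2 x t) \<longlongrightarrow> - (- 1) * x powr \<rho>) at_top"
      by (rule Lim_transform_eventually)
    then show "((\<lambda>t. R_fun r \<delta> \<theta> q\<^sub>1 q\<^sub>2 t powr ((q\<^sub>h - 1) / (q\<^sub>2 - 1)) *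
        consumption r \<delta> \<theta> U\<^sub>1 U\<^sub>2 x t) \<longlongrightarrow> x powr ((q\<^sub>h - 1) / (min q\<^sub>1 q\<^sub>2 - 1))) at_top"
      unfolding \<rho>_def q_def by simp
  qed
qed

end
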